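(* Let $E=(E^0,E^1,r,s)$ be a graph and let $K$ be a field. Suppose that $H \subseteq E^0$ is a saturated hereditary subset of vertices and $S \subseteq B_H$ is a subset of breaking vertices for $H$. Then the graded ideal $I_{(H,S)}$ in $L_K(E)$ is isomorphic (as a $K$-algebra) to $L_K(\overline{E}_{(H,S)})$.
   Context: Graphs. A graph $E=(E^0,E^1,r,s)$ consists of a set $E^0$ of vertices, a set $E^1$ of edges, and maps $r,s:E^1\to E^0$ (range and source). A vertex $v$ is regular if $0<|s^{-1}(v)|<\infty$; $E^0_{\mathrm{reg}}$ is the set of regular vertices. A path of length $n\ge 1$ is a sequence $\alpha=e_1\ldots e_n$ of edges with $r(e_i)=s(e_{i+1})$ for $1\le i\le n-1$; put $|\alpha|=n$, $s(\alpha)=s(e_1)$, $r(\alpha)=r(e_n)$. Vertices are paths of length $0$ with $r(v)=s(v)=v$. $E^*$ is the set of all finite paths. Leavitt path algebra. $L_K(E)$ is the free associative $K$-algebra generated by a set $\{v:v\in E^0\}$ of pairwise orthogonal idempotents together with a set $\{e,e^*:e\in E^1\}$ of elements, modulo the ideal generated by the relations: (1) $s(e)e=er(e)=e$ for all $e\in E^1$; (2) $r(e)e^*=e^*s(e)=e^*$ for all $e\in E^1$; (3) $e^*f=\delta_{e,f}\,r(e)$ for all $e,f\in E^1$; (4) $v=\sum_{\{e\in E^1:s(e)=v\}}ee^*$ for all $v\in E^0_{\mathrm{reg}}$. (Algebras are not assumed unital.) It is $\mathbb{Z}$-graded with vertices in degree $0$, $e$ in degree $1$ and $e^*$ in degree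 $-1$. Ideals. A subset $H\subseteq E^0$ is hereditary if $e\in E^1$ and $s(e)\in H$ imply $r(e)\in H$; a hereditary $H$ is saturated if every $v\in E^0_{\mathrm{reg}}$ with $r(s^{-1}(v))\subseteq H$ belongs to $H$. For $H$ saturated hereditary, the set of breaking vertices is $$B_H:=\{v\in E^0: |s^{-1}(v)|=\infty \text{ and } 0<|s^{-1}(v)\cap r^{-1}(E^0\setminus H)|<\infty\}.$$ For $v\in B_H$ the gap idempotent is $v^H:=v-\sum_{s(e)=v,\ r(e)\notin H}ee^*$. For $S\subseteq B_H$, $I_{(H,S)}$ is the two-sided ideal of $L_K(E)$ generated by $\{v:v\in H\}\cup\{v^H:v\in S\}$. The graph $\overline{E}_{(H,S)}$. Define $$F_1(H,S):=\{\alpha\in E^*: \alpha=e_1\ldots e_n \text{ with } n\ge 1,\ r(e_n)\in H \text{ and } s(e_n)\notin H\cup S\},$$ $$F_2(H,S):=\{\alpha\in E^*: |\alpha|\ge 1 \text{ and } r(\alpha)\in S\}.$$ These sets are disjoint. For $i=1,2$ let $\overline{F}_i(H,S)$ denote another copy of $F_i(H,S)$, and write $\overline{\alpha}$ for the copy of $\alpha$ in $\overline{F}_i(H,S)$. Then $\overline{E}_{(H,S)}$ is the graph with (disjoint unions) $$\overline{E}_{(H,S)}^0:=H\cup S\cup F_1(H,S)\cup F_2(H,S),$$ $$\overline{E}_{(H,S)}^1:=\{e\in E^1:s(e)\in H\}\cup\{e\in E^1:s(e)\in S,\ r(e)\in H\}\cup\overline{F}_1(H,S)\cup\overline{F}_2(H,S),$$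 where edges coming from $E^1$ keep their source and range, and $s(\overline{\alpha})=\alpha$, $r(\overline{\alpha})=r(\alpha)$ for $\overline{\alpha}\in\overline{F}_1(H,S)\cup\overline{F}_2(H,S)$. Here $F_1(H,S)$ and $F_2(H,S)$ are used as sets of new vertices. *)

theory Defs
  imports "HOL-Library.Poly_Mapping" "Graph_Theory.Arc_Walk"
begin

section \<open>Algebras over a field, not necessarily unital\<close>

record ('k, 'a) nu_algebra =
  acarrier :: "'a set"
  azero :: "'a"
  aadd :: "'a \<Rightarrow> 'a \<Rightarrow> 'a"
  amult :: "'a \<Rightarrow> 'a \<Rightarrow> 'a"
  ascale :: "'k \<Rightarrow> 'a \<Rightarrow> 'a"

definition alg_subspace :: "('k, 'a) nu_algebra \<Rightarrow> 'a set \<Rightarrow> bool" where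
  "alg_subspace A V \<longleftrightarrow>
     V \<subseteq> acarrier A \<and> azero A \<in> V \<and>
     (\<forall>x\<in>V. \<forall>y\<in>V. aadd A x y \<in> V) \<and>
     (\<forall>c. \<forall>x\<in>V. ascale A c x \<in> V)"

definition alg_span :: "('k, 'a) nu_algebra \<Rightarrow> 'a set \<Rightarrow> 'a set" where
  "alg_span A X = \<Inter>{V. alg_subspace A V \<and> X \<subseteq> V}"

definition alg_ideal :: "('k, 'a) nu_algebra \<Rightarrow> 'a set \<Rightarrow> bool" where
  "alg_ideal A I \<longleftrightarrow>
     alg_subspace A I \<and> (\<forall>a\<in>acarrier A. \<forall>x\<in>I. amult A a x \<in> I \<and> amult A x a \<in> I)"

definition alg_genideal :: "('k, 'a) nu_algebra \<Rightarrow> 'a set \<Rightarrow> 'a set" where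
  "alg_genideal A X = \<Inter>{I. alg_ideal A I \<and> X \<subseteq> I}"

definition alg_coset :: "('k, 'a) nu_algebra \<Rightarrow> 'a set \<Rightarrow> 'a \<Rightarrow> 'a set" where
  "alg_coset A I p = aadd A p ` I"

definition alg_quotient :: "('k, 'a) nu_algebra \<Rightarrow> 'a set \<Rightarrow> ('k, 'a set) nu_algebra" where
  "alg_quotient A I =
     \<lparr>acarrier = alg_coset A I ` acarrier A,
      azero = alg_coset A I (azero A),
      aadd = (\<lambda>X Y. \<Union>x\<in>X. \<Union>y\<in>Y. alg_coset A I (aadd A x y)),
      amult = (\<lambda>X Y. \<Union>x\<in>X. \<Union>y\<in>Y. alg_coset A I (amult A x y)),
      ascale = (\<lambda>c X. \<Union>x\<in>X. alg_coset A I (ascale A c x))\<rparr>"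

definition alg_iso :: "('k, 'a) nu_algebra \<Rightarrow> ('k, 'b) nu_algebra \<Rightarrow> ('a \<Rightarrow> 'b) \<Rightarrow> bool" where
  "alg_iso A B f \<longleftrightarrow>
     bij_betw f (acarrier A) (acarrier B) \<and>
     (\<forall>x\<in>acarrier A. \<forall>y\<in>acarrier A.
        f (aadd A x y) = aadd B (f x) (f y) \<and> f (amult A x y) = amult B (f x) (f y)) \<and>
     (\<forall>c. \<forall>x\<in>acarrier A. f (ascale A c x) = ascale B c (f x))"

definition alg_isomorphic :: "('k, 'a) nu_algebra \<Rightarrow> ('k, 'b) nu_algebra \<Rightarrow> bool" where
  "alg_isomorphic A B \<longleftrightarrow> (\<exists>f. alg_iso A B f)"

text \<open>For a grading \<open>L\<close> of \<open>A\<close>, an ideal is graded if it is the (automatically direct) sum of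
  its intersections with the homogeneous components.\<close>

definition graded_ideal ::
    "('k, 'a) nu_algebra \<Rightarrow> (int \<Rightarrow> 'a set) \<Rightarrow> 'a set \<Rightarrow> bool" where
  "graded_ideal A L I \<longleftrightarrow> alg_ideal A I \<and> I = alg_span A (\<Union>n. I \<inter> L n)"


section \<open>The free associative algebra without unit\<close>

datatype 'g word = Word (letters: "'g list")

instantiation word :: (type) monoid_add
begin
definition zero_word :: "'a word" where "0 = Word []"
definition plus_word :: "'a word \<Rightarrow> 'a word \<Rightarrow> 'a word" where
  "u + w = Word (letters u @ letters w)"
instance by standard (simp_all add: zero_word_def plus_word_def)
end

text \<open>With concatenation as addition of words, the product of \<open>'g word \<Rightarrow>\<^sub>0 'k\<close> is that of
  noncommutative polynomials. The type also contains the constants (multiples of the empty word);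
  the carrier below excludes them.\<close>

definition free_algebra :: "'g set \<Rightarrow> ('k::field, 'g word \<Rightarrow>\<^sub>0 'k) nu_algebra" where
  "free_algebra X =
     \<lparr>acarrier = {p. \<forall>w\<in>Poly_Mapping.keys p. letters w \<noteq> [] \<and> set (letters w) \<subseteq> X},
      azero = 0,
      aadd = (+),
      amult = (*),
      ascale = (\<lambda>c. Poly_Mapping.map ((*) c))\<rparr>"

definition gen :: "'g \<Rightarrow> ('g word \<Rightarrow>\<^sub>0 'k::field)" where
  "gen x = Poly_Mapping.single (Word [x]) 1"


section \<open>Leavitt path algebras\<close>

text \<open>Graphs are \<open>wf_digraph\<close>s, with \<open>tail\<close> as source map \<open>s\<close> and \<open>head\<close> as range map \<open>r\<close>;
  \<open>out_arcs E v\<close> is the \<open>s\<close>-preimage of \<open>v\<close>.\<close>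

definition regular_vertex :: "('v, 'e) pre_digraph \<Rightarrow> 'v \<Rightarrow> bool" where
  "regular_vertex E v \<longleftrightarrow> v \<in> verts E \<and> out_arcs E v \<noteq> {} \<and> finite (out_arcs E v)"

datatype ('v, 'e) lpa_gen = Vert 'v | Edge 'e | Ghost 'e

definition lpa_gens :: "('v, 'e) pre_digraph \<Rightarrow> ('v, 'e) lpa_gen set" where
  "lpa_gens E = Vert ` verts E \<union> Edge ` arcs E \<union> Ghost ` arcs E"

text \<open>Each relation \<open>a = b\<close> is given as the element \<open>a - b\<close>. The first set says that the
  vertices are pairwise orthogonal idempotents.\<close>

definition lpa_relations ::
    "('v, 'e) pre_digraph \<Rightarrow> (('v, 'e) lpa_gen word \<Rightarrow>\<^sub>0 'k::field) set" where
  "lpa_relations E =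
     {gen (Vert v) * gen (Vert w) - (if v = w then gen (Vert v) else 0) |v w.
        v \<in> verts E \<and> w \<in> verts E} \<union>
     {gen (Vert (tail E e)) * gen (Edge e) - gen (Edge e) |e. e \<in> arcs E} \<union>
     {gen (Edge e) * gen (Vert (head E e)) - gen (Edge e) |e. e \<in> arcs E} \<union>
     {gen (Vert (head E e)) * gen (Ghost e) - gen (Ghost e) |e. e \<in> arcs E} \<union>
     {gen (Ghost e) * gen (Vert (tail E e)) - gen (Ghost e) |e. e \<in> arcs E} \<union>
     {gen (Ghost e) * gen (Edge f) - (if e = f then gen (Vert (head E e)) else 0) |e f.
        e \<in> arcs E \<and> f \<in> arcs E} \<union>
     {gen (Vert v) - (\<Sum>e\<in>out_arcs E v. gen (Edge e) * gen (Ghost e)) |v. regular_vertex E v}"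

type_synonym ('v, 'e, 'k) lpa_elem = "(('v, 'e) lpa_gen word \<Rightarrow>\<^sub>0 'k) set"

definition lpa :: "('v, 'e) pre_digraph \<Rightarrow> ('k::field, ('v, 'e, 'k) lpa_elem) nu_algebra" where
  "lpa E = alg_quotient (free_algebra (lpa_gens E))
             (alg_genideal (free_algebra (lpa_gens E)) (lpa_relations E))"

definition lpa_class ::
    "('v, 'e) pre_digraph \<Rightarrow> (('v, 'e) lpa_gen word \<Rightarrow>\<^sub>0 'k::field) \<Rightarrow> ('v, 'e, 'k) lpa_elem" where
  "lpa_class E = alg_coset (free_algebra (lpa_gens E))
             (alg_genideal (free_algebra (lpa_gens E)) (lpa_relations E))"

fun gen_degree :: "('v, 'e) lpa_gen \<Rightarrow> int" where
  "gen_degree (Vert v) = 0"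
| "gen_degree (Edge e) = 1"
| "gen_degree (Ghost e) = -1"

definition lpa_component :: "('v, 'e) pre_digraph \<Rightarrow> int \<Rightarrow> ('v, 'e, 'k::field) lpa_elem set" where
  "lpa_component E n = lpa_class E `
     {p \<in> acarrier (free_algebra (lpa_gens E)).
        \<forall>w\<in>Poly_Mapping.keys p. sum_list (map gen_degree (letters w)) = n}"


section \<open>The ideals \<open>I_(H,S)\<close>\<close>

definition hereditary :: "('v, 'e) pre_digraph \<Rightarrow> 'v set \<Rightarrow> bool" where
  "hereditary E H \<longleftrightarrow> H \<subseteq> verts E \<and> (\<forall>e\<in>arcs E. tail E e \<in> H \<longrightarrow> head E e \<in> H)"

definition saturated :: "('v, 'e) pre_digraph \<Rightarrow> 'v set \<Rightarrow> bool" where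
  "saturated E H \<longleftrightarrow> (\<forall>v. regular_vertex E v \<and> head E ` out_arcs E v \<subseteq> H \<longrightarrow> v \<in> H)"

definition outside_arcs :: "('v, 'e) pre_digraph \<Rightarrow> 'v set \<Rightarrow> 'v \<Rightarrow> 'e set" where
  "outside_arcs E H v = {e \<in> out_arcs E v. head E e \<notin> H}"

definition breaking_vertices :: "('v, 'e) pre_digraph \<Rightarrow> 'v set \<Rightarrow> 'v set" where
  "breaking_vertices E H = {v \<in> verts E. infinite (out_arcs E v) \<and>
     outside_arcs E H v \<noteq> {} \<and> finite (outside_arcs E H v)}"

definition gap_idempotent ::
    "('v, 'e) pre_digraph \<Rightarrow> 'v set \<Rightarrow> 'v \<Rightarrow> ('v, 'e, 'k::field) lpa_elem" where
  "gap_idempotent E H v =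
     lpa_class E (gen (Vert v) - (\<Sum>e\<in>outside_arcs E H v. gen (Edge e) * gen (Ghost e)))"

definition ideal_HS ::
    "('v, 'e) pre_digraph \<Rightarrow> 'v set \<Rightarrow> 'v set \<Rightarrow> ('v, 'e, 'k::field) lpa_elem set" where
  "ideal_HS E H S = alg_genideal (lpa E)
     ((\<lambda>v. lpa_class E (gen (Vert v))) ` H \<union> gap_idempotent E H ` S)"

definition ideal_algebra ::
    "('v, 'e) pre_digraph \<Rightarrow> 'v set \<Rightarrow> 'v set \<Rightarrow> ('k::field, ('v, 'e, 'k) lpa_elem) nu_algebra" where
  "ideal_algebra E H S = (lpa E)\<lparr>acarrier := ideal_HS E H S\<rparr>"


section \<open>The graph of \<open>(H,S)\<close>\<close>

text \<open>A path of positive length is the list of its edges.\<close>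

definition nonempty_paths :: "('v, 'e) pre_digraph \<Rightarrow> 'e list set" where
  "nonempty_paths E = {p. p \<noteq> [] \<and> (\<exists>u v. pre_digraph.awalk E u p v)}"

definition F1 :: "('v, 'e) pre_digraph \<Rightarrow> 'v set \<Rightarrow> 'v set \<Rightarrow> 'e list set" where
  "F1 E H S = {p \<in> nonempty_paths E. head E (last p) \<in> H \<and> tail E (last p) \<notin> H \<union> S}"

definition F2 :: "('v, 'e) pre_digraph \<Rightarrow> 'v set \<Rightarrow> 'v set \<Rightarrow> 'e list set" where
  "F2 E H S = {p \<in> nonempty_paths E. head E (last p) \<in> S}"

text \<open>Plain unions are used where the sets are disjoint anyway (\<open>H\<close> and \<open>S\<close>; \<open>F1\<close> and \<open>F2\<close>;
  the two sets of old edges). The left summand holds the old vertices and edges. In the right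
  summand a path is the new vertex \<open>\<alpha>\<close>, respectively the new edge from \<open>\<alpha>\<close> to \<open>r(\<alpha>)\<close>.\<close>

definition hs_graph ::
    "('v, 'e) pre_digraph \<Rightarrow> 'v set \<Rightarrow> 'v set \<Rightarrow> ('v + 'e list, 'e + 'e list) pre_digraph" where
  "hs_graph E H S =
     \<lparr>verts = (H \<union> S) <+> (F1 E H S \<union> F2 E H S),
      arcs = ({e \<in> arcs E. tail E e \<in> H} \<union> {e \<in> arcs E. tail E e \<in> S \<and> head E e \<in> H})
               <+> (F1 E H S \<union> F2 E H S),
      tail = case_sum (\<lambda>e. Inl (tail E e)) Inr,
      head = case_sum (\<lambda>e. Inl (head E e)) (\<lambda>p. Inl (head E (last p)))\<rparr>"

end

theory Submission
  imports Defs
begin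

text \<open>Write \<open>v\<^sup>H\<close> for the gap idempotent, which is \<open>v\<close> itself when \<open>v \<in> H\<close>, and put
  \<open>M_w = \<alpha> v\<^sup>H\<close>, \<open>N_w = v\<^sup>H \<alpha>\<^sup>*\<close> for a new vertex \<open>w\<close>, where \<open>\<alpha>\<close> is the path \<open>w\<close> and \<open>v\<close> its range
  (\<open>\<alpha>\<close> is empty for an old vertex). Then \<open>N_u M_w = \<delta>_(u,w) v\<^sup>H\<close>, so \<open>w \<mapsto> M_w N_w\<close>, together with
  \<open>M_\<alpha>\<close> and \<open>N_\<alpha>\<close> for the new edge \<open>\<alpha>\<close> and its ghost, defines a homomorphism \<open>\<Phi>\<close> from the new Leavitt
  path algebra to \<open>L(E)\<close>. Multiplying a generator of \<open>L(E)\<close> by \<open>M_w N_w\<close> stays in the image of \<open>\<Phi>\<close>, so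
  the image is the ideal. The same multiplication table, read as a definition, makes \<open>L(E)\<close> act on
  the new algebra so that \<open>\<Phi>(x)\<close> acts as left multiplication by \<open>x\<close>; since the new algebra has local
  units, \<open>\<Phi>\<close> is injective. This replaces the graded uniqueness theorem, and the same family of
  images is homogeneous, which makes the ideal graded.\<close>

section \<open>Noncommutative polynomials\<close>

text \<open>The orthonormality rests on one fact about first edges: an old edge runs from
  \<open>H \<union> S\<close> into \<open>H\<close>, while a path of \<open>F\<close> that starts in
  \<open>H \<union> S\<close> has a first edge ending outside \<open>H\<close>. A gap idempotent
  fixes the old edges at its vertex and annihilates the other ones, so a path never cancels against
  a proper extension of it. L(E) need not act through elements of the new algebra: a vertex
  \<open>v\<close> of \<open>E\<close> acts like the possibly infinite sum of all new vertices with
  source \<open>v\<close>. Both algebras are therefore represented in a ring of additive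
  endomorphisms. Since a generator \<open>a\<close> satisfies a = s(a)a, the product xa has to be (x
  s(a))a with x s(a) taken from the table; this descends to the quotient because every relator has a
  single source. The algebras have no unit, but the polynomial type has one and contains the
  constants. The unit makes the regular representation of a quotient faithful; in return, the
  operators of the action have to vanish on constants, so that they are determined by their products
  with vertices.\<close>

abbreviation const :: "'k \<Rightarrow> ('g word \<Rightarrow>\<^sub>0 'k::field)" where
  "const c \<equiv> Poly_Mapping.single 0 c"

lemma sum_single_keys:
  fixes p :: "'a \<Rightarrow>\<^sub>0 'b::comm_monoid_add"
  shows "(\<Sum>k\<in>Poly_Mapping.keys p. Poly_Mapping.single k (Poly_Mapping.lookup p k)) = p"
proof (rule poly_mapping_eqI)
  fix k
  show "Poly_Mapping.lookup (\<Sum>k\<in>Poly_Mapping.keys p. Poly_Mapping.single k (Poly_Mapping.lookup p k)) k = Poly_Mapping.lookup p k"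
    by (auto simp: lookup_sum lookup_single when_def in_keys_iff)
qed

lemma npoly_induct [case_names zero single add]:
  fixes p :: "'a \<Rightarrow>\<^sub>0 'b::comm_monoid_add"
  assumes "P 0"
    and single: "\<And>w c. w \<in> Poly_Mapping.keys p \<Longrightarrow> P (Poly_Mapping.single w c)"
    and add: "\<And>p q. P p \<Longrightarrow> P q \<Longrightarrow> P (p + q)"
  shows "P p"
proof -
  have "P (\<Sum>k\<in>A. Poly_Mapping.single k (Poly_Mapping.lookup p k))" if "A \<subseteq> Poly_Mapping.keys p" for A
    using finite_subset[OF that finite_keys] that
    by (induction A rule: finite_induct) (auto simp: assms)
  from this[OF order_refl] show ?thesis by (simp add: sum_single_keys)
qed

text \<open>The coefficient is an argument of \<open>f\<close>, so additivity in it is the only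
  condition. This covers both evaluations in rings and the operators \<open>translate\<close>, which
  are not multiplicative.\<close>

definition linear_extension :: "('g word \<Rightarrow> 'k::field \<Rightarrow> 'r::ab_group_add) \<Rightarrow> ('g word \<Rightarrow>\<^sub>0 'k) \<Rightarrow> 'r" where
  "linear_extension f p = (\<Sum>w\<in>Poly_Mapping.keys p. f w (Poly_Mapping.lookup p w))"

lemma linear_extension_add:
  assumes f: "\<And>w a b. f w (a + b) = f w a + f w b"
  shows "linear_extension f (p + q) = linear_extension f p + linear_extension f q"
proof -
  have z: "f w 0 = 0" for w using f[of w 0 0] by simp
  have sup: "linear_extension f x = (\<Sum>w\<in>A. f w (Poly_Mapping.lookup x w))"
    if "finite A" "Poly_Mapping.keys x \<subseteq> A" for x A
    unfolding linear_extension_def using that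
    by (intro sum.mono_neutral_left) (auto simp: in_keys_iff z)
  let ?A = "Poly_Mapping.keys p \<union> Poly_Mapping.keys q"
  have "linear_extension f (p + q) = (\<Sum>w\<in>?A. f w (Poly_Mapping.lookup (p + q) w))"
    by (rule sup) (use keys_add[of p q] in auto)
  also have "\<dots> = (\<Sum>w\<in>?A. f w (Poly_Mapping.lookup p w)) + (\<Sum>w\<in>?A. f w (Poly_Mapping.lookup q w))"
    by (simp add: lookup_add f sum.distrib)
  also have "\<dots> = linear_extension f p + linear_extension f q"
    using sup[of ?A p] sup[of ?A q] by simp
  finally show ?thesis .
qed

lemma linear_extension_single:
  assumes "f w 0 = 0"
  shows "linear_extension f (Poly_Mapping.single w c) = f w c"
  using assms by (simp add: linear_extension_def)

lemma map_scale_eq: "Poly_Mapping.map ((*) c) p = const c * p"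
  by (rule mult_map_scale_conv_mult)

lemma const_commute: "const c * p = p * const c"
  by (induction p rule: npoly_induct) (auto simp: mult_single distrib_left distrib_right mult.commute)

lemma single_Cons:
  "Poly_Mapping.single (Word (x # xs)) c = gen x * Poly_Mapping.single (Word xs) c"
  by (simp add: gen_def mult_single plus_word_def)

lemma word_Nil [simp]: "Word [] = 0"
  unfolding zero_word_def ..

lemma letters_0 [simp]: "letters 0 = []"
  by (metis word.sel word_Nil)

lemma keys_gen [simp]: "Poly_Mapping.keys (gen x :: _ \<Rightarrow>\<^sub>0 'k::field) = {Word [x]}"
  by (simp add: gen_def)

text \<open>Units need not be preserved: the representation \<open>rep\<close> below sends 1 to the
  projection \<open>P\<close>.\<close>

definition ring_map :: "('a::ring \<Rightarrow> 'b::ring) \<Rightarrow> bool" where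
  "ring_map f \<longleftrightarrow> (\<forall>x y. f (x + y) = f x + f y \<and> f (x * y) = f x * f y)"

lemma
  assumes "ring_map f"
  shows ring_map_add: "f (x + y) = f x + f y"
    and ring_map_mult: "f (x * y) = f x * f y"
    and ring_map_0: "f 0 = 0"
    and ring_map_diff: "f (x - y) = f x - f y"
    and ring_map_sum: "f (\<Sum>i\<in>A. g i) = (\<Sum>i\<in>A. f (g i))"
proof -
  show a: "f (x + y) = f x + f y" for x y using assms by (simp add: ring_map_def)
  show "f (x * y) = f x * f y" using assms by (simp add: ring_map_def)
  show z: "f 0 = 0" using a[of 0 0] by simp
  show "f (x - y) = f x - f y" using a[of "x - y" y] by simp
  show "f (\<Sum>i\<in>A. g i) = (\<Sum>i\<in>A. f (g i))"
    by (induction A rule: infinite_finite_induct) (auto simp: a z)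
qed

text \<open>Scalars enter through the map \<open>s\<close> because there are two kinds of targets:
  polynomials, with \<open>s = const\<close>, and endomorphisms, where \<open>s c\<close> is
  multiplication by \<open>const c\<close>.\<close>

locale evaluation =
  fixes s :: "'k::field \<Rightarrow> 'r::ring_1" and h :: "'g \<Rightarrow> 'r"
  assumes s_add: "s (a + b) = s a + s b"
    and s_mult: "s (a * b) = s a * s b"
    and s_one: "s 1 = 1"
    and s_commute: "s a * h x = h x * s a"
begin

lemma s_zero: "s 0 = 0"
  using s_add[of 0 0] by simp

definition eval :: "('g word \<Rightarrow>\<^sub>0 'k) \<Rightarrow> 'r" where
  "eval = linear_extension (\<lambda>w c. s c * prod_list (map h (letters w)))"

lemma eval_add: "eval (p + q) = eval p + eval q"
  unfolding eval_def by (rule linear_extension_add) (simp add: s_add distrib_right)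

lemma eval_single: "eval (Poly_Mapping.single w c) = s c * prod_list (map h (letters w))"
  unfolding eval_def by (rule linear_extension_single) (simp add: s_zero)

lemma s_commute_prod_list: "s a * prod_list (map h xs) = prod_list (map h xs) * s a"
proof (induction xs)
  case (Cons x xs)
  have "s a * (h x * prod_list (map h xs)) = h x * (s a * prod_list (map h xs))"
    by (simp add: s_commute flip: mult.assoc)
  then show ?case using Cons by (simp add: mult.assoc)
qed simp

lemma eval_0: "eval 0 = 0"
  using eval_single[of 0 0] by (simp add: s_zero)

lemma eval_mult: "eval (p * q) = eval p * eval q"
proof (induction p rule: npoly_induct)
  case (single u a)
  show ?case
  proof (induction q rule: npoly_induct)
    case (single w b)
    let ?u = "prod_list (map h (letters u))" and ?w = "prod_list (map h (letters w))"
    have "s b * (?u * ?w) = ?u * (s b * ?w)"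
      by (metis mult.assoc s_commute_prod_list)
    then show ?case
      by (simp add: mult_single eval_single plus_word_def s_mult mult.assoc)
  qed (simp_all add: distrib_left eval_add eval_0)
qed (simp_all add: distrib_right eval_add eval_0)

lemma ring_map_eval: "ring_map eval"
  by (simp add: ring_map_def eval_add eval_mult)

lemma eval_gen [simp]: "eval (gen x) = h x"
  by (simp add: gen_def eval_single s_one)

lemma eval_const [simp]: "eval (const c) = s c"
  by (simp add: eval_single)

lemma eval_single_Cons: "eval (Poly_Mapping.single (Word (x # xs)) c) = h x * eval (Poly_Mapping.single (Word xs) c)"
  by (simp add: single_Cons eval_mult)

end

lemma evaluation_const: "evaluation const (h :: 'g \<Rightarrow> ('b word \<Rightarrow>\<^sub>0 'k::field))"
  by unfold_locales (simp_all add: single_add mult_single const_commute)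

section \<open>Two-sided ideals and the free algebra without unit\<close>

inductive_set two_sided_ideal :: "'r::ring_1 set \<Rightarrow> 'r set" for R where
  zero: "0 \<in> two_sided_ideal R"
| add: "r \<in> R \<Longrightarrow> y \<in> two_sided_ideal R \<Longrightarrow> a * r * b + y \<in> two_sided_ideal R"

lemma two_sided_ideal_incl: "r \<in> R \<Longrightarrow> r \<in> two_sided_ideal R"
  using two_sided_ideal.add[OF _ two_sided_ideal.zero, of r R 1 1] by simp

lemma two_sided_ideal_add:
  "x \<in> two_sided_ideal R \<Longrightarrow> y \<in> two_sided_ideal R \<Longrightarrow> x + y \<in> two_sided_ideal R"
  by (induction rule: two_sided_ideal.induct) (auto simp: add.assoc intro: two_sided_ideal.add)

lemma two_sided_ideal_mult_left: "x \<in> two_sided_ideal R \<Longrightarrow> a * x \<in> two_sided_ideal R"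
proof (induction rule: two_sided_ideal.induct)
  case (add r y b c)
  then have "(a * b) * r * c + a * y \<in> two_sided_ideal R" by (intro two_sided_ideal.add)
  then show ?case by (simp add: algebra_simps)
qed (simp add: two_sided_ideal.zero)

lemma two_sided_ideal_mult_right: "x \<in> two_sided_ideal R \<Longrightarrow> x * a \<in> two_sided_ideal R"
proof (induction rule: two_sided_ideal.induct)
  case (add r y b c)
  then have "b * r * (c * a) + y * a \<in> two_sided_ideal R" by (intro two_sided_ideal.add)
  then show ?case by (simp add: algebra_simps)
qed (simp add: two_sided_ideal.zero)

lemma two_sided_ideal_uminus: "x \<in> two_sided_ideal R \<Longrightarrow> - x \<in> two_sided_ideal R"
  using two_sided_ideal_mult_left[of x R "-1"] by simp

lemma two_sided_ideal_diff:
  "x \<in> two_sided_ideal R \<Longrightarrow> y \<in> two_sided_ideal R \<Longrightarrow> x - y \<in> two_sided_ideal R"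
  using two_sided_ideal_add[of x R "- y"] two_sided_ideal_uminus[of y R] by simp

lemma ring_map_vanishes_on_ideal:
  assumes f: "ring_map f" and R: "\<And>r. r \<in> R \<Longrightarrow> f r = 0" and x: "x \<in> two_sided_ideal R"
  shows "f x = 0"
  using x by induction (simp_all add: R ring_map_0[OF f] ring_map_add[OF f] ring_map_mult[OF f])

abbreviation poly_carrier :: "'g set \<Rightarrow> ('g word \<Rightarrow>\<^sub>0 'k::field) set" where
  "poly_carrier X \<equiv> acarrier (free_algebra X)"

lemma poly_carrier_iff:
  "p \<in> poly_carrier X \<longleftrightarrow> (\<forall>w\<in>Poly_Mapping.keys p. letters w \<noteq> [] \<and> set (letters w) \<subseteq> X)"
  by (simp add: free_algebra_def)

lemma free_algebra_ops [simp]: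
  "azero (free_algebra X) = 0" "aadd (free_algebra X) = (+)" "amult (free_algebra X) = (*)"
  "ascale (free_algebra X) c p = const c * p"
  by (simp_all add: free_algebra_def map_scale_eq)

lemma poly_carrier_0 [simp]: "0 \<in> poly_carrier X"
  by (simp add: poly_carrier_iff)

lemma poly_carrier_add: "p \<in> poly_carrier X \<Longrightarrow> q \<in> poly_carrier X \<Longrightarrow> p + q \<in> poly_carrier X"
  unfolding poly_carrier_iff using keys_add[of p q] by blast

lemma poly_carrier_diff: "p \<in> poly_carrier X \<Longrightarrow> q \<in> poly_carrier X \<Longrightarrow> p - q \<in> poly_carrier X"
  unfolding poly_carrier_iff using keys_diff[of p q] by blast

lemma poly_carrier_mult: "p \<in> poly_carrier X \<Longrightarrow> q \<in> poly_carrier X \<Longrightarrow> p * q \<in> poly_carrier X"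
  unfolding poly_carrier_iff using keys_mult[of p q] by (fastforce simp: plus_word_def)

lemma poly_carrier_scale: "p \<in> poly_carrier X \<Longrightarrow> const c * p \<in> poly_carrier X"
  unfolding poly_carrier_iff using keys_mult[of "const c" p] by (fastforce split: if_splits)

lemma poly_carrier_sum: "(\<And>i. i \<in> A \<Longrightarrow> p i \<in> poly_carrier X) \<Longrightarrow> (\<Sum>i\<in>A. p i) \<in> poly_carrier X"
  by (induction A rule: infinite_finite_induct) (auto intro: poly_carrier_add)

lemma poly_carrier_gen [simp]: "gen x \<in> poly_carrier X \<longleftrightarrow> x \<in> X"
  by (simp add: poly_carrier_iff)

text \<open>The empty word is excluded from the carrier, so the induction starts at single letters.
  The scalar stays with the tail of a word, and \<open>Cons\<close> multiplies by a bare
  generator.\<close>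

lemma poly_carrier_induct [consumes 1, case_names zero gen Cons add]:
  assumes p: "p \<in> poly_carrier X"
    and zero: "P 0"
    and gen: "\<And>x c. x \<in> X \<Longrightarrow> P (const c * gen x)"
    and Cons: "\<And>x xs c. x \<in> X \<Longrightarrow> xs \<noteq> [] \<Longrightarrow> set xs \<subseteq> X \<Longrightarrow> P (Poly_Mapping.single (Word xs) c)
       \<Longrightarrow> P (gen x * Poly_Mapping.single (Word xs) c)"
    and add: "\<And>p q. P p \<Longrightarrow> P q \<Longrightarrow> P (p + q)"
  shows "P p"
proof (induction p rule: npoly_induct)
  case (single w c)
  have *: "P (Poly_Mapping.single (Word xs) c)" if "xs \<noteq> []" "set xs \<subseteq> X" for xs
    using that
  proof (induction xs)
    case (Cons x xs)
    show ?case
    proof (cases "xs = []")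
      case True
      then show ?thesis using gen[of x c] Cons.prems by (simp add: gen_def mult_single)
    next
      case False
      then show ?thesis using assms(4)[of x xs c] Cons by (simp add: single_Cons)
    qed
  qed simp
  obtain xs where "w = Word xs" by (cases w)
  with single p show ?case using *[of xs] by (auto simp: poly_carrier_iff)
qed (auto intro: zero add)

lemma alg_subspace_poly_iff:
  "alg_subspace (free_algebra X) V \<longleftrightarrow> V \<subseteq> poly_carrier X \<and> 0 \<in> V \<and>
     (\<forall>x\<in>V. \<forall>y\<in>V. x + y \<in> V) \<and> (\<forall>c. \<forall>x\<in>V. const c * x \<in> V)"
  by (simp add: alg_subspace_def)

text \<open>Making the generators outside \<open>X\<close> zero turns the ideal of the non-unital algebra on \<open>X\<close>
  into the trace of an ideal of the whole ring type, whose multipliers are unrestricted.\<close>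

lemma alg_genideal_free_algebra:
  assumes R: "R \<subseteq> poly_carrier X"
  shows "alg_genideal (free_algebra X) R = two_sided_ideal (R \<union> gen ` (- X)) \<inter> poly_carrier X"
    (is "?L = ?J \<inter> _")
proof
  have "alg_ideal (free_algebra X) (?J \<inter> poly_carrier X)"
    unfolding alg_ideal_def alg_subspace_poly_iff
    by (auto intro: two_sided_ideal_mult_left two_sided_ideal_mult_right two_sided_ideal_add
        two_sided_ideal.zero poly_carrier_add poly_carrier_mult poly_carrier_scale)
  moreover have "R \<subseteq> ?J \<inter> poly_carrier X"
    using R by (auto intro: two_sided_ideal_incl)
  ultimately show "?L \<subseteq> ?J \<inter> poly_carrier X"
    unfolding alg_genideal_def by blast
next
  \<comment> \<open>This evaluation is the retraction onto polynomials in \<open>X\<close>: it fixes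
    \<open>R\<close> and kills the added relators \<open>gen x\<close> with
    \<open>x \<notin> X\<close>.\<close>
  interpret evaluation const "\<lambda>x. if x \<in> X then gen x else 0 :: 'a word \<Rightarrow>\<^sub>0 'b"
    by (rule evaluation_const)
  have eval_X: "eval (Poly_Mapping.single (Word xs) c) = Poly_Mapping.single (Word xs) c"
    if "set xs \<subseteq> X" for xs c
    using that by (induction xs) (simp_all add: eval_mult single_Cons)
  have eval_id: "eval p = p" if "p \<in> poly_carrier X" for p
    using that
    by (induction rule: poly_carrier_induct)
      (auto simp: eval_0 eval_add eval_mult eval_X)
  show "?J \<inter> poly_carrier X \<subseteq> ?L"
    unfolding alg_genideal_def
  proof safe
    fix p I assume p: "p \<in> ?J" "p \<in> poly_carrier X"
      and I: "alg_ideal (free_algebra X) I" and RI: "R \<subseteq> I"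
    from I have I0: "0 \<in> I" and Iadd: "\<And>x y. x \<in> I \<Longrightarrow> y \<in> I \<Longrightarrow> x + y \<in> I"
      and Ic: "\<And>c x. x \<in> I \<Longrightarrow> const c * x \<in> I"
      and Im: "\<And>a x. a \<in> poly_carrier X \<Longrightarrow> x \<in> I \<Longrightarrow> a * x \<in> I \<and> x * a \<in> I"
      by (auto simp: alg_ideal_def alg_subspace_poly_iff)
    \<comment> \<open>After retraction a multiplier is a constant plus an element of the carrier.
      The constant acts as a scalar, the rest as a legitimate multiplier of the non-unital
      algebra.\<close>
    have I_eval: "eval a * x \<in> I \<and> x * eval a \<in> I" if "x \<in> I" for a x
    proof (induction a rule: npoly_induct)
      case (single w c)
      obtain xs where w: "w = Word xs" by (cases w)
      have "eval (Poly_Mapping.single (Word xs) c) = 0 \<or> xs = [] \<or>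
          eval (Poly_Mapping.single (Word xs) c) \<in> poly_carrier X"
      proof (cases "set xs \<subseteq> X")
        case True
        then show ?thesis by (auto simp: eval_X poly_carrier_iff)
      next
        case False
        then have "eval (Poly_Mapping.single (Word xs) c) = 0"
          by (induction xs) (auto simp: eval_single_Cons)
        then show ?thesis ..
      qed
      then show ?case
        using Im[OF _ that] Ic[OF that] I0 by (auto simp: w const_commute[of c x, symmetric])
    qed (auto simp: eval_0 eval_add distrib_left distrib_right I0 Iadd)
    have "eval p \<in> I"
      using p(1)
    proof induction
      case (add r y a b)
      have "eval r \<in> I"
        using add(1) RI eval_id[OF subsetD[OF R], of r] I0 by auto
      then show ?case
        using I_eval[of "eval a * eval r" b] I_eval[of "eval r" a] Iadd add(3)
        by (auto simp: eval_add eval_mult)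
    qed (simp add: eval_0 I0)
    then show "p \<in> I" using eval_id[OF p(2)] by simp
  qed
qed

section \<open>Additive endomorphisms and quotients\<close>

text \<open>A common ring for the new algebra, acting by left multiplication, and for L(E), acting
  by table. Only additivity is built in; linearity is stated as commutation with
  \<open>left_mult (const c)\<close>.\<close>

typedef (overloaded) 'a endo = "{f :: 'a::ring_1 \<Rightarrow> 'a. \<forall>x y. f (x + y) = f x + f y}"
  morphisms app Endo
  by (rule exI[of _ "\<lambda>x. x"]) simp

setup_lifting type_definition_endo

lemma app_add: "app f (x + y) = app f x + app f y"
  by transfer simp

lemma app_0 [simp]: "app f 0 = 0"
  using app_add[of f 0 0] by simp

lemma app_diff: "app f (x - y) = app f x - app f y"
  using app_add[of f "x - y" y] by simp

lemma endo_eqI: "(\<And>x. app f x = app g x) \<Longrightarrow> f = g"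
  by transfer auto

instantiation endo :: (ring_1) ring_1
begin

lift_definition zero_endo :: "'a endo" is "\<lambda>x. 0" by simp
lift_definition one_endo :: "'a endo" is "\<lambda>x. x" by simp
lift_definition plus_endo :: "'a endo \<Rightarrow> 'a endo \<Rightarrow> 'a endo" is "\<lambda>f g x. f x + g x"
  by (simp add: algebra_simps)
lift_definition minus_endo :: "'a endo \<Rightarrow> 'a endo \<Rightarrow> 'a endo" is "\<lambda>f g x. f x - g x"
  by (simp add: algebra_simps)
lift_definition uminus_endo :: "'a endo \<Rightarrow> 'a endo" is "\<lambda>f x. - f x"
  by simp
lift_definition times_endo :: "'a endo \<Rightarrow> 'a endo \<Rightarrow> 'a endo" is "\<lambda>f g x. f (g x)"
  by simp

instance
proof
  fix a b c :: "'a endo"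
  show "a * b * c = a * (b * c)" "1 * a = a" "a * 1 = a" "a + b + c = a + (b + c)" "a + b = b + a"
    "0 + a = a" "- a + a = 0" "a - b = a + - b" "(a + b) * c = a * c + b * c"
    by (transfer; simp add: fun_eq_iff algebra_simps)+
  show "a * (b + c) = a * b + a * c"
    by transfer (simp add: fun_eq_iff)
  show "(0 :: 'a endo) \<noteq> 1"
    by transfer (auto simp: fun_eq_iff intro: exI[of _ 1])
qed

end

lemmas app_simps = zero_endo.rep_eq one_endo.rep_eq plus_endo.rep_eq minus_endo.rep_eq times_endo.rep_eq

lift_definition left_mult :: "'a::ring_1 \<Rightarrow> 'a endo" is "\<lambda>a x. a * x"
  by (simp add: distrib_left)

lemma app_left_mult [simp]: "app (left_mult a) x = a * x"
  by transfer simp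

text \<open>Quotients cannot be formed as types inside a proof; a linear projection with kernel \<open>J\<close>
  replaces the quotient map.\<close>

lemma exists_projection:
  fixes J :: "('g word \<Rightarrow>\<^sub>0 'k::field) set"
  assumes J: "0 \<in> J" "\<And>x y. x \<in> J \<Longrightarrow> y \<in> J \<Longrightarrow> x + y \<in> J" "\<And>c x. x \<in> J \<Longrightarrow> const c * x \<in> J"
  shows "\<exists>P. (\<forall>x. app P x = 0 \<longleftrightarrow> x \<in> J) \<and> (\<forall>x. x - app P x \<in> J)
    \<and> (\<forall>c x. app P (const c * x) = const c * app P x)"
proof -
  interpret vector_space_pair "\<lambda>c (p :: 'g word \<Rightarrow>\<^sub>0 'k). const c * p" "\<lambda>c (p :: 'g word \<Rightarrow>\<^sub>0 'k). const c * p"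
    by unfold_locales (simp_all add: algebra_simps single_add mult_single flip: mult.assoc)
  have "Vector_Spaces.linear (\<lambda>c p. const c * p) (\<lambda>c p. const c * p) (\<lambda>x :: 'g word \<Rightarrow>\<^sub>0 'k. x)"
    by unfold_locales simp_all
  moreover have "vs1.subspace J"
    using J by (simp add: vs1.subspace_def)
  \<comment> \<open>A linear left inverse of the identity on \<open>J\<close> is a retraction onto
    \<open>J\<close>; the desired projection is its complement \<open>x - f x\<close>.\<close>
  ultimately obtain f where f: "range f \<subseteq> J"
    and lin: "Vector_Spaces.linear (\<lambda>c p. const c * p) (\<lambda>c p. const c * p) f" and id: "\<And>v. v \<in> J \<Longrightarrow> f v = v"
    using linear_exists_left_inverse_on[of "\<lambda>x. x" J] by auto
  interpret f: Vector_Spaces.linear "\<lambda>c p. const c * p" "\<lambda>c p. const c * p" f by (rule lin)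
  have P: "app (Endo (\<lambda>x. x - f x)) x = x - f x" for x
    by (subst Endo_inverse) (simp_all add: f.add)
  show ?thesis
  proof (intro exI[of _ "Endo (\<lambda>x. x - f x)"] conjI allI)
    fix x
    show "app (Endo (\<lambda>x. x - f x)) x = 0 \<longleftrightarrow> x \<in> J"
      using f id[of x] by (auto simp: P)
    show "x - app (Endo (\<lambda>x. x - f x)) x \<in> J"
      using f by (auto simp: P)
    show "app (Endo (\<lambda>x. x - f x)) (const c * x) = const c * app (Endo (\<lambda>x. x - f x)) x" for c
      by (simp add: P f.scale algebra_simps)
  qed
qed

locale quotient_projection =
  fixes R :: "('g word \<Rightarrow>\<^sub>0 'k::field) set" and P :: "('g word \<Rightarrow>\<^sub>0 'k) endo"
  assumes kernel: "app P x = 0 \<longleftrightarrow> x \<in> two_sided_ideal R"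
    and residue: "x - app P x \<in> two_sided_ideal R"
    and linear: "app P (const c * x) = const c * app P x"
begin

lemma app_eq_iff: "app P x = app P y \<longleftrightarrow> x - y \<in> two_sided_ideal R"
  using kernel[of "x - y"] by (simp add: app_diff)

lemma app_mult_app: "app P (a * app P x) = app P (a * x)"
  using two_sided_ideal_mult_left[OF residue, of a x] app_eq_iff[of "a * x" "a * app P x"]
  by (simp add: algebra_simps)

text \<open>The left regular representation of the quotient by the ideal, on the representatives
  chosen by \<open>P\<close>. Congruence of polynomials becomes equality of endomorphisms.\<close>

definition rep :: "('g word \<Rightarrow>\<^sub>0 'k) \<Rightarrow> ('g word \<Rightarrow>\<^sub>0 'k) endo" where
  "rep p = P * left_mult p"

lemma app_rep: "app (rep p) x = app P (p * x)"
  by (simp add: rep_def app_simps)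

lemma ring_map_rep: "ring_map rep"
  unfolding ring_map_def
  by (auto intro!: endo_eqI simp: app_simps app_rep app_mult_app app_add distrib_right mult.assoc)

text \<open>Faithfulness comes from applying the endomorphism to the unit of the polynomial
  ring.\<close>

lemma rep_eq_0_iff: "rep p = 0 \<longleftrightarrow> p \<in> two_sided_ideal R"
proof
  assume "rep p = 0"
  then have "app P (p * 1) = 0" by (metis app_rep zero_endo.rep_eq)
  then show "p \<in> two_sided_ideal R" by (simp add: kernel)
next
  assume "p \<in> two_sided_ideal R"
  then show "rep p = 0"
    by (intro endo_eqI) (simp add: app_rep app_simps kernel two_sided_ideal_mult_right)
qed

lemma rep_eq_iff: "rep p = rep q \<longleftrightarrow> p - q \<in> two_sided_ideal R"
  using rep_eq_0_iff[of "p - q"] by (simp add: ring_map_diff[OF ring_map_rep])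

end

lemma exists_quotient_projection:
  fixes R :: "('g word \<Rightarrow>\<^sub>0 'k::field) set"
  shows "\<exists>P. quotient_projection R P"
  using exists_projection[of "two_sided_ideal R"]
  by (auto simp: quotient_projection_def two_sided_ideal.zero two_sided_ideal_add two_sided_ideal_mult_left)

section \<open>The relations of Leavitt path algebras in a ring\<close>

text \<open>With the foreign generators as extra relators, the ideal of the whole polynomial ring
  meets the carrier exactly in the ideal defining the Leavitt path algebra.\<close>

definition lpa_relators :: "('v, 'e) pre_digraph \<Rightarrow> (('v, 'e) lpa_gen word \<Rightarrow>\<^sub>0 'k::field) set" where
  "lpa_relators E = lpa_relations E \<union> gen ` (- lpa_gens E)"

lemma Vert_gens [simp]: "Vert v \<in> lpa_gens E \<longleftrightarrow> v \<in> verts E"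
  and Edge_gens [simp]: "Edge e \<in> lpa_gens E \<longleftrightarrow> e \<in> arcs E"
  and Ghost_gens [simp]: "Ghost e \<in> lpa_gens E \<longleftrightarrow> e \<in> arcs E"
  by (auto simp: lpa_gens_def)

text \<open>Families satisfying the Leavitt relations in a ring. Being zero outside the generators
  mirrors the extra relators and frees the product rules below from most membership
  conditions.\<close>

locale lpa_family = wf_digraph E for E :: "('v, 'e) pre_digraph" +
  fixes g :: "('v, 'e) lpa_gen \<Rightarrow> 'r::ring"
  assumes outside: "x \<notin> lpa_gens E \<Longrightarrow> g x = 0"
    and vert_vert': "v \<in> verts E \<Longrightarrow> w \<in> verts E \<Longrightarrow>
      g (Vert v) * g (Vert w) = (if v = w then g (Vert v) else 0)"
    and tail_edge: "e \<in> arcs E \<Longrightarrow> g (Vert (tail E e)) * g (Edge e) = g (Edge e)"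
    and edge_head: "e \<in> arcs E \<Longrightarrow> g (Edge e) * g (Vert (head E e)) = g (Edge e)"
    and head_ghost: "e \<in> arcs E \<Longrightarrow> g (Vert (head E e)) * g (Ghost e) = g (Ghost e)"
    and ghost_tail: "e \<in> arcs E \<Longrightarrow> g (Ghost e) * g (Vert (tail E e)) = g (Ghost e)"
    and ghost_edge': "e \<in> arcs E \<Longrightarrow> f \<in> arcs E \<Longrightarrow>
      g (Ghost e) * g (Edge f) = (if e = f then g (Vert (head E e)) else 0)"
    and regular_sum: "regular_vertex E v \<Longrightarrow>
      g (Vert v) = (\<Sum>e\<in>out_arcs E v. g (Edge e) * g (Ghost e))"
begin

lemma vert_vert: "g (Vert v) * g (Vert w) = (if v = w then g (Vert v) else 0)"
  using outside[of "Vert v"] outside[of "Vert w"] vert_vert'[of v w]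
  by (cases "v \<in> verts E"; cases "w \<in> verts E") auto

lemma outside_arc: "e \<notin> arcs E \<Longrightarrow> g (Edge e) = 0" "e \<notin> arcs E \<Longrightarrow> g (Ghost e) = 0"
  by (auto intro: outside)

lemma vert_edge: "g (Vert v) * g (Edge e) = (if v = tail E e then g (Edge e) else 0)"
proof (cases "e \<in> arcs E")
  case True
  have "(g (Vert v) * g (Vert (tail E e))) * g (Edge e) = (if v = tail E e then g (Edge e) else 0)"
    by (auto simp: vert_vert tail_edge[OF True])
  then show ?thesis by (simp only: mult.assoc tail_edge[OF True])
qed (simp add: outside_arc)

lemma vert_ghost: "g (Vert v) * g (Ghost e) = (if v = head E e then g (Ghost e) else 0)"
proof (cases "e \<in> arcs E")
  case True
  have "(g (Vert v) * g (Vert (head E e))) * g (Ghost e) = (if v = head E e then g (Ghost e) else 0)"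
    by (auto simp: vert_vert head_ghost[OF True])
  then show ?thesis by (simp only: mult.assoc head_ghost[OF True])
qed (simp add: outside_arc)

lemma edge_vert: "g (Edge e) * g (Vert v) = (if v = head E e then g (Edge e) else 0)"
proof (cases "e \<in> arcs E")
  case True
  have "g (Edge e) * (g (Vert (head E e)) * g (Vert v)) = (if v = head E e then g (Edge e) else 0)"
    by (auto simp: vert_vert edge_head[OF True])
  then show ?thesis by (simp only: mult.assoc[symmetric] edge_head[OF True])
qed (simp add: outside_arc)

lemma ghost_vert: "g (Ghost e) * g (Vert v) = (if v = tail E e then g (Ghost e) else 0)"
proof (cases "e \<in> arcs E")
  case True
  have "g (Ghost e) * (g (Vert (tail E e)) * g (Vert v)) = (if v = tail E e then g (Ghost e) else 0)"
    by (auto simp: vert_vert ghost_tail[OF True])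
  then show ?thesis by (simp only: mult.assoc[symmetric] ghost_tail[OF True])
qed (simp add: outside_arc)

lemma ghost_edge: "g (Ghost e) * g (Edge f) = (if e = f \<and> e \<in> arcs E then g (Vert (head E e)) else 0)"
  using ghost_edge'[of e f] outside_arc[of e] outside_arc[of f]
  by (cases "e \<in> arcs E"; cases "f \<in> arcs E") auto

lemma
  shows vert_vert_assoc: "g (Vert v) * (g (Vert w) * z) = (if v = w then g (Vert v) * z else 0)"
    and vert_edge_assoc: "g (Vert v) * (g (Edge e) * z) = (if v = tail E e then g (Edge e) * z else 0)"
    and vert_ghost_assoc: "g (Vert v) * (g (Ghost e) * z) = (if v = head E e then g (Ghost e) * z else 0)"
    and edge_vert_assoc: "g (Edge e) * (g (Vert v) * z) = (if v = head E e then g (Edge e) * z else 0)"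
    and ghost_vert_assoc: "g (Ghost e) * (g (Vert v) * z) = (if v = tail E e then g (Ghost e) * z else 0)"
    and ghost_edge_assoc: "g (Ghost e) * (g (Edge f) * z)
        = (if e = f \<and> e \<in> arcs E then g (Vert (head E e)) * z else 0)"
  by (auto simp add: vert_vert vert_edge vert_ghost edge_vert ghost_vert ghost_edge simp flip: mult.assoc)

lemmas lpa_simps = vert_vert vert_edge vert_ghost edge_vert ghost_vert ghost_edge
  vert_vert_assoc vert_edge_assoc vert_ghost_assoc edge_vert_assoc ghost_vert_assoc ghost_edge_assoc

end

fun gen_source :: "('v, 'e) pre_digraph \<Rightarrow> ('v, 'e) lpa_gen \<Rightarrow> 'v" where
  "gen_source E (Vert v) = v"
| "gen_source E (Edge e) = tail E e"
| "gen_source E (Ghost e) = head E e"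

fun gen_range :: "('v, 'e) pre_digraph \<Rightarrow> ('v, 'e) lpa_gen \<Rightarrow> 'v" where
  "gen_range E (Vert v) = v"
| "gen_range E (Edge e) = head E e"
| "gen_range E (Ghost e) = tail E e"

lemma (in lpa_family) vert_gen: "g (Vert v) * g x = (if v = gen_source E x then g x else 0)"
  by (cases x) (auto simp: lpa_simps)

lemma (in lpa_family) gen_vert: "g x * g (Vert v) = (if v = gen_range E x then g x else 0)"
  by (cases x) (auto simp: lpa_simps)

text \<open>The universal property. One direction provides the relations inside a represented
  quotient, the other makes maps given by a family vanish on the defining ideal.\<close>

lemma lpa_family_iff_relators:
  assumes wf: "wf_digraph E" and f: "ring_map f"
  shows "lpa_family E (\<lambda>x. f (gen x)) \<longleftrightarrow> (\<forall>r\<in>lpa_relators E. f r = 0)"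
    (is "?L \<longleftrightarrow> ?R")
proof
  note f_simps = ring_map_mult[OF f] ring_map_0[OF f] ring_map_diff[OF f] ring_map_sum[OF f]
  {
    assume ?L
    then interpret lpa_family E "\<lambda>x. f (gen x)" .
    show ?R
      unfolding lpa_relators_def lpa_relations_def
      by (auto simp: f_simps vert_vert' tail_edge edge_head head_ghost ghost_tail ghost_edge' outside)
        (simp add: regular_sum)
  }
  {
    assume R: ?R
    have rel: "f r = 0" if "r \<in> lpa_relations E" for r
      using R that by (simp add: lpa_relators_def)
    interpret wf_digraph E by (rule wf)
    show ?L
    proof
      show "f (gen x) = 0" if "x \<notin> lpa_gens E" for x
        using R that by (simp add: lpa_relators_def)
    next
      fix v w assume "v \<in> verts E" "w \<in> verts E"
      then have "f (gen (Vert v) * gen (Vert w) - (if v = w then gen (Vert v) else 0)) = 0"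
        by (intro rel) (unfold lpa_relations_def, blast)
      then show "f (gen (Vert v)) * f (gen (Vert w)) = (if v = w then f (gen (Vert v)) else 0)"
        by (auto simp: f_simps split: if_splits)
    next
      fix e f' assume "e \<in> arcs E" "f' \<in> arcs E"
      then have "f (gen (Ghost e) * gen (Edge f') - (if e = f' then gen (Vert (head E e)) else 0)) = 0"
        by (intro rel) (unfold lpa_relations_def, blast)
      then show "f (gen (Ghost e)) * f (gen (Edge f')) = (if e = f' then f (gen (Vert (head E e))) else 0)"
        by (auto simp: f_simps split: if_splits)
    next
      fix v assume "regular_vertex E v"
      then have "f (gen (Vert v) - (\<Sum>e\<in>out_arcs E v. gen (Edge e) * gen (Ghost e))) = 0"
        by (intro rel) (unfold lpa_relations_def, blast)
      then show "f (gen (Vert v)) = (\<Sum>e\<in>out_arcs E v. f (gen (Edge e)) * f (gen (Ghost e)))"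
        by (simp add: f_simps)
    next
      fix e assume e: "e \<in> arcs E"
      have "f (gen (Vert (tail E e)) * gen (Edge e) - gen (Edge e)) = 0"
        "f (gen (Edge e) * gen (Vert (head E e)) - gen (Edge e)) = 0"
        "f (gen (Vert (head E e)) * gen (Ghost e) - gen (Ghost e)) = 0"
        "f (gen (Ghost e) * gen (Vert (tail E e)) - gen (Ghost e)) = 0"
        by (rule rel; use e in \<open>unfold lpa_relations_def, blast\<close>)+
      then show "f (gen (Vert (tail E e))) * f (gen (Edge e)) = f (gen (Edge e))"
        "f (gen (Edge e)) * f (gen (Vert (head E e))) = f (gen (Edge e))"
        "f (gen (Vert (head E e))) * f (gen (Ghost e)) = f (gen (Ghost e))"
        "f (gen (Ghost e)) * f (gen (Vert (tail E e))) = f (gen (Ghost e))"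
        by (simp_all add: f_simps)
    qed
  }
qed

section \<open>Cosets in Leavitt path algebras\<close>

abbreviation lpa_ideal :: "('v, 'e) pre_digraph \<Rightarrow> (('v, 'e) lpa_gen word \<Rightarrow>\<^sub>0 'k::field) set" where
  "lpa_ideal E \<equiv> two_sided_ideal (lpa_relators E)"

abbreviation lpa_carrier :: "('v, 'e) pre_digraph \<Rightarrow> (('v, 'e) lpa_gen word \<Rightarrow>\<^sub>0 'k::field) set" where
  "lpa_carrier E \<equiv> poly_carrier (lpa_gens E)"

lemma lpa_relations_carrier:
  assumes "wf_digraph E"
  shows "lpa_relations E \<subseteq> lpa_carrier E"
proof -
  interpret wf_digraph E by fact
  show ?thesis
    unfolding lpa_relations_def
    by (auto simp: regular_vertex_def intro!: poly_carrier_diff poly_carrier_mult poly_carrier_sum)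
qed

lemma lpa_genideal:
  assumes "wf_digraph E"
  shows "alg_genideal (free_algebra (lpa_gens E)) (lpa_relations E) = lpa_ideal E \<inter> lpa_carrier E"
  using alg_genideal_free_algebra[OF lpa_relations_carrier[OF assms]] by (simp add: lpa_relators_def)

lemma lpa_class_eq_image:
  assumes "wf_digraph E"
  shows "lpa_class E p = (+) p ` (lpa_ideal E \<inter> lpa_carrier E)"
  by (simp add: lpa_class_def alg_coset_def lpa_genideal[OF assms])

lemma mem_lpa_class:
  assumes "wf_digraph E" "p \<in> lpa_carrier E"
  shows "x \<in> lpa_class E p \<longleftrightarrow> x \<in> lpa_carrier E \<and> x - p \<in> lpa_ideal E"
proof
  assume "x \<in> lpa_class E p"
  then show "x \<in> lpa_carrier E \<and> x - p \<in> lpa_ideal E"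
    using assms by (auto simp: lpa_class_eq_image intro: poly_carrier_add)
next
  assume "x \<in> lpa_carrier E \<and> x - p \<in> lpa_ideal E"
  then show "x \<in> lpa_class E p"
    using assms poly_carrier_diff[of x _ p]
    by (auto simp: lpa_class_eq_image intro!: image_eqI[of _ _ "x - p"])
qed

lemma lpa_class_eq_iff:
  assumes "wf_digraph E" "p \<in> lpa_carrier E" "q \<in> lpa_carrier E"
  shows "lpa_class E p = lpa_class E q \<longleftrightarrow> p - q \<in> lpa_ideal E"
proof
  assume "lpa_class E p = lpa_class E q"
  moreover have "p \<in> lpa_class E p"
    using assms by (simp add: mem_lpa_class two_sided_ideal.zero)
  ultimately show "p - q \<in> lpa_ideal E"
    using assms by (simp add: mem_lpa_class)
next
  assume pq: "p - q \<in> lpa_ideal E"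
  have "x - p \<in> lpa_ideal E \<longleftrightarrow> x - q \<in> lpa_ideal E" for x
    using two_sided_ideal_add[OF _ pq, of "x - p"] two_sided_ideal_diff[OF _ pq, of "x - q"]
    by (auto simp: algebra_simps)
  then show "lpa_class E p = lpa_class E q"
    using assms by (auto simp: mem_lpa_class set_eq_iff)
qed

lemma lpa_carrier_eq: "acarrier (lpa E) = lpa_class E ` lpa_carrier E"
  by (simp add: lpa_def alg_quotient_def lpa_class_def)

lemma lpa_zero: "azero (lpa E) = lpa_class E 0"
  by (simp add: lpa_def alg_quotient_def lpa_class_def)

text \<open>Operations on a quotient are unions over representatives; such a union collapses to one
  coset once the result does not depend on the representative.\<close>

lemma UN_lpa_class_eq:
  assumes wf: "wf_digraph E" and p: "p \<in> lpa_carrier E" "c \<in> lpa_carrier E"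
    and f: "\<And>x. x \<in> lpa_class E p \<Longrightarrow> f x \<in> lpa_carrier E \<and> f x - c \<in> lpa_ideal E"
  shows "(\<Union>x\<in>lpa_class E p. lpa_class E (f x)) = lpa_class E c"
proof -
  have "p \<in> lpa_class E p"
    using wf p by (simp add: mem_lpa_class two_sided_ideal.zero)
  moreover have "lpa_class E (f x) = lpa_class E c" if "x \<in> lpa_class E p" for x
    using f[OF that] by (simp add: lpa_class_eq_iff wf p)
  ultimately show ?thesis by auto
qed

lemma UN2_lpa_class_eq:
  assumes wf: "wf_digraph E" and p: "p \<in> lpa_carrier E" "q \<in> lpa_carrier E" "c \<in> lpa_carrier E"
    and f: "\<And>x y. x \<in> lpa_class E p \<Longrightarrow> y \<in> lpa_class E q \<Longrightarrow>
      f x y \<in> lpa_carrier E \<and> f x y - c \<in> lpa_ideal E"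
  shows "(\<Union>x\<in>lpa_class E p. \<Union>y\<in>lpa_class E q. lpa_class E (f x y)) = lpa_class E c"
proof -
  have "(\<Union>y\<in>lpa_class E q. lpa_class E (f x y)) = lpa_class E c" if "x \<in> lpa_class E p" for x
    by (rule UN_lpa_class_eq[OF wf p(2,3)]) (use f that in auto)
  moreover have "p \<in> lpa_class E p"
    using wf p by (simp add: mem_lpa_class two_sided_ideal.zero)
  ultimately show ?thesis by auto
qed

lemma
  assumes wf: "wf_digraph E" and p: "p \<in> lpa_carrier E" and q: "q \<in> lpa_carrier E"
  shows lpa_add: "aadd (lpa E) (lpa_class E p) (lpa_class E q) = lpa_class E (p + q)"
    and lpa_mult: "amult (lpa E) (lpa_class E p) (lpa_class E q) = lpa_class E (p * q)"
proof -
  have *: "aadd (lpa E) X Y = (\<Union>x\<in>X. \<Union>y\<in>Y. lpa_class E (x + y))"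
    "amult (lpa E) X Y = (\<Union>x\<in>X. \<Union>y\<in>Y. lpa_class E (x * y))" for X Y
    by (simp_all add: lpa_def alg_quotient_def lpa_class_def)
  show "aadd (lpa E) (lpa_class E p) (lpa_class E q) = lpa_class E (p + q)"
    unfolding *
    by (rule UN2_lpa_class_eq[OF wf p q])
      (use wf p q in \<open>auto simp: mem_lpa_class add_diff_add intro: poly_carrier_add two_sided_ideal_add\<close>)
  have "x * y - p * q \<in> lpa_ideal E" if "x - p \<in> lpa_ideal E" "y - q \<in> lpa_ideal E" for x y
  proof -
    have "x * y - p * q = (x - p) * y + p * (y - q)" by (simp add: algebra_simps)
    then show ?thesis
      using that by (simp add: two_sided_ideal_add two_sided_ideal_mult_left two_sided_ideal_mult_right)
  qed
  then show "amult (lpa E) (lpa_class E p) (lpa_class E q) = lpa_class E (p * q)"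
    unfolding *
    by (intro UN2_lpa_class_eq[OF wf p q])
      (use wf p q in \<open>auto simp: mem_lpa_class intro: poly_carrier_mult\<close>)
qed

lemma lpa_scale:
  assumes wf: "wf_digraph E" and p: "p \<in> lpa_carrier E"
  shows "ascale (lpa E) c (lpa_class E p) = lpa_class E (const c * p)"
proof -
  have *: "ascale (lpa E) c X = (\<Union>x\<in>X. lpa_class E (const c * x))" for X
    by (simp add: lpa_def alg_quotient_def lpa_class_def)
  show ?thesis
    unfolding *
    by (rule UN_lpa_class_eq[OF wf p])
      (use wf p in \<open>auto simp: mem_lpa_class two_sided_ideal_mult_left right_diff_distrib[symmetric]
        intro: poly_carrier_scale\<close>)
qed

section \<open>The graph of \<open>(H,S)\<close>\<close>

definition vpath :: "'v + 'e list \<Rightarrow> 'e list" where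
  "vpath = case_sum (\<lambda>_. []) (\<lambda>p. p)"

definition vrange :: "('v, 'e) pre_digraph \<Rightarrow> 'v + 'e list \<Rightarrow> 'v" where
  "vrange E = case_sum (\<lambda>v. v) (\<lambda>p. head E (last p))"

definition vsource :: "('v, 'e) pre_digraph \<Rightarrow> 'v + 'e list \<Rightarrow> 'v" where
  "vsource E = case_sum (\<lambda>v. v) (\<lambda>p. tail E (hd p))"

lemma vpath_simps [simp]: "vpath (Inl v) = []" "vpath (Inr p) = p"
  and vrange_simps [simp]: "vrange E (Inl v) = v" "vrange E (Inr p) = head E (last p)"
  and vsource_simps [simp]: "vsource E (Inl v) = v" "vsource E (Inr p) = tail E (hd p)"
  by (simp_all add: vpath_def vrange_def vsource_def)

locale hs_data = wf_digraph E for E :: "('v, 'e) pre_digraph" +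
  fixes H S :: "'v set"
  assumes hereditary: "hereditary E H"
    and breaking: "S \<subseteq> breaking_vertices E H"
begin

definition "F = F1 E H S \<union> F2 E H S"
abbreviation "G \<equiv> hs_graph E H S"

lemma hereditaryD: "e \<in> arcs E \<Longrightarrow> tail E e \<in> H \<Longrightarrow> head E e \<in> H"
  using hereditary by (auto simp: hereditary_def)

lemma H_verts: "v \<in> H \<Longrightarrow> v \<in> verts E"
  using hereditary by (auto simp: hereditary_def)

lemma S_verts: "v \<in> S \<Longrightarrow> v \<in> verts E"
  using breaking by (auto simp: breaking_vertices_def)

lemma S_not_H: "v \<in> S \<Longrightarrow> v \<notin> H"
  using breaking hereditaryD by (auto simp: breaking_vertices_def outside_arcs_def)

lemma outside_arcs_H: "v \<in> H \<Longrightarrow> outside_arcs E H v = {}"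
  using hereditaryD by (auto simp: outside_arcs_def)

lemma finite_outside_arcs: "v \<in> H \<union> S \<Longrightarrow> finite (outside_arcs E H v)"
  using outside_arcs_H[of v] breaking by (auto simp: breaking_vertices_def)

lemma nonempty_paths_Cons:
  "e # p \<in> nonempty_paths E \<longleftrightarrow>
     e \<in> arcs E \<and> (p = [] \<or> p \<in> nonempty_paths E \<and> head E e = tail E (hd p))"
proof -
  have 1: "(\<exists>u v. awalk u (e # p) v) \<longleftrightarrow> e \<in> arcs E \<and> (\<exists>v. awalk (head E e) p v)"
    by (auto simp: awalk_Cons_iff)
  show ?thesis
  proof (cases p)
    case Nil
    then show ?thesis using 1 by (auto simp: nonempty_paths_def awalk_Nil_iff)
  next
    case (Cons f p')
    then have "(\<exists>v. awalk (head E e) p v) \<longleftrightarrow> head E e = tail E (hd p) \<and> (\<exists>u v. awalk u p v)"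
      by (auto simp: awalk_Cons_iff)
    then show ?thesis using 1 Cons by (auto simp: nonempty_paths_def)
  qed
qed

lemma F_not_Nil [simp]: "[] \<notin> F"
  by (auto simp: F_def F1_def F2_def nonempty_paths_def)

lemma F_single: "[e] \<in> F \<longleftrightarrow> e \<in> arcs E \<and> (head E e \<in> H \<and> tail E e \<notin> H \<union> S \<or> head E e \<in> S)"
  by (auto simp: F_def F1_def F2_def nonempty_paths_Cons)

text \<open>Both defining conditions of \<open>F\<close> concern only the last edge, so paths can be
  shortened and extended at the front. All inductions on paths rely on this.\<close>

lemma F_Cons: "p \<noteq> [] \<Longrightarrow> e # p \<in> F \<longleftrightarrow> e \<in> arcs E \<and> head E e = tail E (hd p) \<and> p \<in> F"
  by (auto simp: F_def F1_def F2_def nonempty_paths_Cons)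

lemma F_last: "p \<in> F \<Longrightarrow> head E (last p) \<in> H \<union> S"
  by (auto simp: F_def F1_def F2_def)

lemma F_hd_arc: "p \<in> F \<Longrightarrow> hd p \<in> arcs E"
  by (cases p; cases "tl p = []") (auto simp: F_single F_Cons)

text \<open>A path starting in \<open>H\<close> stays there by heredity, but the last edge of a path
  in \<open>F\<close> starts outside \<open>H\<close>: by definition in \<open>F1\<close>, and in
  \<open>F2\<close> because it ends in \<open>S\<close>, which is disjoint from
  \<open>H\<close>.\<close>

lemma F_hd_not_H: "p \<in> F \<Longrightarrow> tail E (hd p) \<notin> H"
proof (induction p)
  case (Cons e p)
  show ?case
  proof (cases "p = []")
    case True
    then show ?thesis using Cons(2) S_not_H hereditaryD[of e] by (auto simp: F_single)
  next
    case False
    then show ?thesis using Cons hereditaryD[of e] by (auto simp: F_Cons)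
  qed
qed (metis F_not_Nil)

text \<open>Separates new paths from old edges. A single edge starting in
  \<open>H \<union> S\<close> can only be in \<open>F2\<close> and ends in \<open>S\<close>; in a
  longer path the first edge ends where the remaining path starts, which is outside
  \<open>H\<close>.\<close>

lemma F_hd_new: "p \<in> F \<Longrightarrow> tail E (hd p) \<in> H \<union> S \<Longrightarrow> head E (hd p) \<notin> H"
proof (cases p)
  case (Cons e q)
  assume *: "p \<in> F" "tail E (hd p) \<in> H \<union> S"
  show ?thesis
  proof (cases "q = []")
    case True
    then show ?thesis using * S_not_H Cons by (auto simp: F_single)
  next
    case False
    then show ?thesis using * F_hd_not_H[of q] Cons by (auto simp: F_Cons)
  qed
qed (metis F_not_Nil)

lemma verts_G [simp]: "Inl v \<in> verts G \<longleftrightarrow> v \<in> H \<union> S" "Inr p \<in> verts G \<longleftrightarrow> p \<in> F"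
  and arcs_G [simp]: "Inl e \<in> arcs G \<longleftrightarrow> e \<in> arcs E \<and> tail E e \<in> H \<union> S \<and> head E e \<in> H"
    "Inr p \<in> arcs G \<longleftrightarrow> p \<in> F"
  using hereditaryD by (auto simp: hs_graph_def F_def)

lemma ends_G [simp]: "tail G (Inl e) = Inl (tail E e)" "tail G (Inr p) = Inr p"
    "head G (Inl e) = Inl (head E e)" "head G (Inr p) = Inl (head E (last p))"
  by (simp_all add: hs_graph_def)

lemma wf_G: "wf_digraph G"
proof
  fix a assume "a \<in> arcs G"
  then show "tail G a \<in> verts G" "head G a \<in> verts G"
    by (cases a; simp; use F_last in \<open>auto\<close>)+
qed

lemma vrange_HS: "w \<in> verts G \<Longrightarrow> vrange E w \<in> H \<union> S"
  by (cases w) (use F_last in \<open>auto\<close>)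

lemma vsource_verts: "w \<in> verts G \<Longrightarrow> vsource E w \<in> verts E"
  by (cases w) (use H_verts S_verts F_hd_arc in \<open>auto\<close>)

lemma out_arcs_G: "out_arcs G (Inr p) = (if p \<in> F then {Inr p} else {})"
  "v \<in> H \<Longrightarrow> out_arcs G (Inl v) = Inl ` out_arcs E v"
proof -
  show "out_arcs G (Inr p) = (if p \<in> F then {Inr p} else {})"
    by (auto simp: out_arcs_def hs_graph_def F_def)
  assume "v \<in> H"
  then show "out_arcs G (Inl v) = Inl ` out_arcs E v"
    using hereditaryD by (auto simp: out_arcs_def hs_graph_def)
qed

text \<open>A breaking vertex loses only its finitely many edges leaving towards the complement of
  \<open>H\<close>. It thus stays non-regular, and the new algebra has no summation relation at
  it.\<close>

lemma infinite_out_arcs_G: "v \<in> S \<Longrightarrow> infinite (out_arcs G (Inl v))"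
proof
  assume v: "v \<in> S" and fin: "finite (out_arcs G (Inl v))"
  have "Inl ` (out_arcs E v - outside_arcs E H v) \<subseteq> out_arcs G (Inl v)"
    using v by (auto simp: outside_arcs_def out_arcs_def)
  then have "finite (out_arcs E v - outside_arcs E H v)"
    using fin by (meson finite_imageD finite_subset inj_Inl)
  then show False
    using v breaking by (auto simp: breaking_vertices_def)
qed

lemma regular_G: "regular_vertex G (Inl v) \<longleftrightarrow> v \<in> H \<and> regular_vertex E v"
proof (cases "v \<in> H")
  case True
  then show ?thesis using H_verts by (simp add: regular_vertex_def out_arcs_G finite_image_iff)
next
  case False
  then show ?thesis using infinite_out_arcs_G[of v] by (auto simp: regular_vertex_def)
qed

end

section \<open>Gap idempotents and the family of images in L(E)\<close>

definition gap :: "('v, 'e) pre_digraph \<Rightarrow> 'v set \<Rightarrow> (('v, 'e) lpa_gen \<Rightarrow> 'r::ring) \<Rightarrow> 'v \<Rightarrow> 'r" where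
  "gap E H g v = g (Vert v) - (\<Sum>e\<in>outside_arcs E H v. g (Edge e) * g (Ghost e))"

text \<open>The family \<open>g\<close> is a parameter because the same expressions are needed for
  polynomials, for the represented L(E) and for the operators \<open>t\<close> of the
  action.\<close>

definition path_gap ::
    "('v, 'e) pre_digraph \<Rightarrow> 'v set \<Rightarrow> (('v, 'e) lpa_gen \<Rightarrow> 'r::ring) \<Rightarrow> 'e list \<Rightarrow> 'v \<Rightarrow> 'r" where
  "path_gap E H g p v = foldr (\<lambda>e x. g (Edge e) * x) p (gap E H g v)"

text \<open>The fold appends each ghost on the right of the value for the remaining path, which
  yields the reversed order that the adjoint of a path requires.\<close>

definition gap_path ::
    "('v, 'e) pre_digraph \<Rightarrow> 'v set \<Rightarrow> (('v, 'e) lpa_gen \<Rightarrow> 'r::ring) \<Rightarrow> 'e list \<Rightarrow> 'v \<Rightarrow> 'r" where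
  "gap_path E H g p v = foldr (\<lambda>e x. x * g (Ghost e)) p (gap E H g v)"

definition hs_image :: "('v, 'e) pre_digraph \<Rightarrow> 'v set \<Rightarrow> 'v set \<Rightarrow> (('v, 'e) lpa_gen \<Rightarrow> 'r::ring)
    \<Rightarrow> ('v + 'e list, 'e + 'e list) lpa_gen \<Rightarrow> 'r" where
  "hs_image E H S g x = (if x \<notin> lpa_gens (hs_graph E H S) then 0 else
     case x of
       Vert w \<Rightarrow> path_gap E H g (vpath w) (vrange E w) * gap_path E H g (vpath w) (vrange E w)
     | Edge a \<Rightarrow> (case a of Inl e \<Rightarrow> g (Edge e) | Inr p \<Rightarrow> path_gap E H g p (head E (last p)))
     | Ghost a \<Rightarrow> (case a of Inl e \<Rightarrow> g (Ghost e) | Inr p \<Rightarrow> gap_path E H g p (head E (last p))))"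

text \<open>The product of the generator \<open>x\<close> of \<open>L(E)\<close> with the vertex \<open>w\<close> of the new graph, expressed in
  the generators \<open>l\<close> of the new Leavitt path algebra (see \<open>gen_hs_vertex\<close>).\<close>

fun left_action :: "('v, 'e) pre_digraph \<Rightarrow> 'v set \<Rightarrow> 'v set \<Rightarrow> (('v + 'e list, 'e + 'e list) lpa_gen \<Rightarrow> 'r::ring)
    \<Rightarrow> ('v, 'e) lpa_gen \<Rightarrow> 'v + 'e list \<Rightarrow> 'r" where
  "left_action E H S l (Vert v) w =
     (if w \<in> verts (hs_graph E H S) \<and> v = vsource E w then l (Vert w) else 0)"
| "left_action E H S l (Edge e) w =
     (if w \<in> verts (hs_graph E H S) \<and> e \<in> arcs E \<and> head E e = vsource E w then
        case w of
          Inl v \<Rightarrow> if Inl e \<in> arcs (hs_graph E H S) then l (Edge (Inl e)) else l (Edge (Inr [e]))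
        | Inr p \<Rightarrow> l (Edge (Inr (e # p))) * l (Ghost (Inr p))
      else 0)"
| "left_action E H S l (Ghost e) w =
     (if w \<in> verts (hs_graph E H S) then
        case w of
          Inl v \<Rightarrow> if v = tail E e then l (Ghost (Inl e)) else 0
        | Inr p \<Rightarrow> if hd p = e then
            if tl p = [] then l (Ghost (Inr p)) else l (Edge (Inr (tl p))) * l (Ghost (Inr p))
          else 0
      else 0)"

locale hs_family = hs_data E H S + lpa_family E g
  for E :: "('v, 'e) pre_digraph" and H S :: "'v set" and g :: "('v, 'e) lpa_gen \<Rightarrow> 'r::ring"
begin

abbreviation "q \<equiv> gap E H g"
abbreviation "mu \<equiv> path_gap E H g"
abbreviation "nu \<equiv> gap_path E H g"
abbreviation "h \<equiv> hs_image E H S g"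

lemma mu_simps: "mu [] v = q v" "mu (e # p) v = g (Edge e) * mu p v"
  and nu_simps: "nu [] v = q v" "nu (e # p) v = nu p v * g (Ghost e)"
  by (simp_all add: path_gap_def gap_path_def)

lemma gap_H: "v \<in> H \<Longrightarrow> q v = g (Vert v)"
  by (simp add: gap_def outside_arcs_H)

lemma vert_gap: "g (Vert u) * q v = (if u = v then q v else 0)"
proof -
  have "(\<Sum>e\<in>outside_arcs E H v. g (Vert u) * (g (Edge e) * g (Ghost e)))
      = (if u = v then \<Sum>e\<in>outside_arcs E H v. g (Edge e) * g (Ghost e) else 0)"
    by (auto simp: lpa_simps outside_arcs_def intro!: sum.cong sum.neutral)
  then show ?thesis by (simp add: gap_def right_diff_distrib sum_distrib_left vert_vert)
qed

lemma gap_vert: "q v * g (Vert u) = (if u = v then q v else 0)"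
proof -
  have "(\<Sum>e\<in>outside_arcs E H v. (g (Edge e) * g (Ghost e)) * g (Vert u))
      = (if u = v then \<Sum>e\<in>outside_arcs E H v. g (Edge e) * g (Ghost e) else 0)"
    by (auto simp: lpa_simps mult.assoc outside_arcs_def intro!: sum.cong sum.neutral)
  then show ?thesis by (simp add: gap_def left_diff_distrib sum_distrib_right vert_vert)
qed

text \<open>In the subtracted sum only the term with \<open>f = e\<close> survives, and it occurs
  exactly if \<open>e\<close> ends outside \<open>H\<close>, where it cancels \<open>e\<close>.
  Finiteness of the sum comes from \<open>v \<in> H \<union> S\<close>.\<close>

lemma gap_edge:
  assumes "v \<in> H \<union> S"
  shows "q v * g (Edge e) = (if v = tail E e \<and> head E e \<in> H then g (Edge e) else 0)"
proof (cases "e \<in> arcs E")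
  case True
  have "(\<Sum>f\<in>outside_arcs E H v. (g (Edge f) * g (Ghost f)) * g (Edge e))
      = (\<Sum>f\<in>outside_arcs E H v. if f = e then g (Edge e) else 0)"
    using True by (auto simp: mult.assoc lpa_simps intro!: sum.cong)
  also have "\<dots> = (if v = tail E e \<and> head E e \<notin> H then g (Edge e) else 0)"
    using finite_outside_arcs[OF assms] True by (auto simp: outside_arcs_def)
  finally show ?thesis
    by (auto simp add: gap_def left_diff_distrib sum_distrib_right lpa_simps)
qed (simp add: outside_arc)

lemma ghost_gap:
  assumes "v \<in> H \<union> S"
  shows "g (Ghost e) * q v = (if v = tail E e \<and> head E e \<in> H then g (Ghost e) else 0)"
proof (cases "e \<in> arcs E")
  case True
  have "(\<Sum>f\<in>outside_arcs E H v. g (Ghost e) * (g (Edge f) * g (Ghost f)))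
      = (\<Sum>f\<in>outside_arcs E H v. if f = e then g (Ghost e) else 0)"
    using True by (auto simp: lpa_simps intro!: sum.cong)
  also have "\<dots> = (if v = tail E e \<and> head E e \<notin> H then g (Ghost e) else 0)"
    using finite_outside_arcs[OF assms] True by (auto simp: outside_arcs_def)
  finally show ?thesis
    by (auto simp add: gap_def right_diff_distrib sum_distrib_left lpa_simps)
qed (simp add: outside_arc)

lemma gap_gap:
  assumes "u \<in> H \<union> S"
  shows "q u * q v = (if u = v then q v else 0)"
proof -
  have "(\<Sum>e\<in>outside_arcs E H v. q u * (g (Edge e) * g (Ghost e))) = 0"
    using assms by (intro sum.neutral) (auto simp: gap_edge outside_arcs_def simp flip: mult.assoc)
  then have "q u * q v = q u * g (Vert v)"
    by (simp add: gap_def[of E H g v] right_diff_distrib sum_distrib_left)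
  then show ?thesis by (auto simp: gap_vert)
qed

lemma mu_gap: "v \<in> H \<union> S \<Longrightarrow> mu p v * q u = (if u = v then mu p v else 0)"
  by (induction p) (auto simp: mu_simps gap_gap mult.assoc)

lemma gap_nu: "v \<in> H \<union> S \<Longrightarrow> u \<in> H \<union> S \<Longrightarrow> q u * nu p v = (if u = v then nu p v else 0)"
  by (induction p) (auto simp: nu_simps gap_gap simp flip: mult.assoc)

lemma vert_mu: "g (Vert u) * mu p v = (if u = (if p = [] then v else tail E (hd p)) then mu p v else 0)"
  by (cases p) (auto simp: mu_simps vert_gap lpa_simps)

lemma nu_vert: "nu p v * g (Vert u) = (if u = (if p = [] then v else tail E (hd p)) then nu p v else 0)"
  by (cases p) (auto simp: nu_simps gap_vert lpa_simps mult.assoc)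

text \<open>The pairs of path and range that belong to new vertices. Keeping the range as a separate
  argument lets an induction strip edges down to the empty path without losing it.\<close>

definition admissible :: "'e list \<Rightarrow> 'v \<Rightarrow> bool" where
  "admissible p v \<longleftrightarrow> v \<in> H \<union> S \<and> (p = [] \<or> p \<in> F \<and> v = head E (last p))"

lemma admissible_Cons:
  assumes "admissible (e # p) v"
  shows "admissible p v" "e \<in> arcs E" "head E e = (if p = [] then v else tail E (hd p))"
    "tail E e \<in> H \<union> S \<Longrightarrow> head E e \<notin> H"
proof -
  have F: "e # p \<in> F" and v: "v \<in> H \<union> S" "v = head E (last (e # p))"
    using assms by (auto simp: admissible_def)
  show "admissible p v"
    using F v by (cases "p = []") (auto simp add: admissible_def F_Cons)
  show "head E e = (if p = [] then v else tail E (hd p))"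
    using F v by (cases "p = []") (simp_all add: F_Cons)
  show "e \<in> arcs E" using F_hd_arc[OF F] by simp
  show "tail E e \<in> H \<union> S \<Longrightarrow> head E e \<notin> H" using F_hd_new[OF F] by simp
qed

text \<open>Equal first edges cancel and distinct ones give 0. If one path is exhausted first, a gap
  meets the first edge of a path in \<open>F\<close> or its ghost; this edge does not run from
  \<open>H \<union> S\<close> into \<open>H\<close>, so the product is 0.\<close>

lemma nu_mu:
  "admissible p u \<Longrightarrow> admissible p' v \<Longrightarrow> nu p u * mu p' v = (if p = p' \<and> u = v then q u else 0)"
proof (induction p arbitrary: p')
  case Nil
  show ?case
  proof (cases p')
    case Nil
    then show ?thesis using Nil.prems by (auto simp: nu_simps mu_simps gap_gap admissible_def)
  next
    case (Cons f p'')
    have "u \<in> H \<union> S" using Nil.prems by (simp add: admissible_def)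
    then show ?thesis
      using Cons admissible_Cons(4)[of f p'' v] Nil.prems
      by (auto simp: nu_simps mu_simps gap_edge simp flip: mult.assoc)
  qed
next
  case (Cons e p)
  note e = admissible_Cons[OF Cons.prems(1)]
  show ?case
  proof (cases p')
    case Nil
    have "v \<in> H \<union> S" using Cons.prems by (simp add: admissible_def)
    then show ?thesis
      using Nil e(4) by (auto simp: nu_simps mu_simps ghost_gap mult.assoc)
  next
    case (Cons f p'')
    note f = admissible_Cons[OF Cons.prems(2)[unfolded Cons]]
    show ?thesis
    proof (cases "e = f")
      case True
      have "nu p u * mu p'' v = (if p = p'' \<and> u = v then q u else 0)"
        by (rule Cons.IH[OF e(1) f(1)])
      then show ?thesis
        using True f(2,3) by (auto simp: Cons nu_simps mu_simps mult.assoc lpa_simps vert_mu)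
    next
      case False
      then show ?thesis by (simp add: Cons nu_simps mu_simps mult.assoc lpa_simps)
    qed
  qed
qed

lemma admissible_verts: "w \<in> verts G \<Longrightarrow> admissible (vpath w) (vrange E w)"
  using vrange_HS[of w] by (cases w) (auto simp: admissible_def)

abbreviation "M w \<equiv> mu (vpath w) (vrange E w)"
abbreviation "N w \<equiv> nu (vpath w) (vrange E w)"

lemma N_M:
  assumes "w \<in> verts G" "w' \<in> verts G"
  shows "N w * M w' = (if w = w' then q (vrange E w) else 0)"
  using nu_mu[OF admissible_verts admissible_verts, OF assms] assms
  by (cases w; cases w') (auto)

lemma hs_image_simps:
  "w \<in> verts G \<Longrightarrow> h (Vert w) = M w * N w"
  "Inl e \<in> arcs G \<Longrightarrow> h (Edge (Inl e)) = g (Edge e)"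
  "Inl e \<in> arcs G \<Longrightarrow> h (Ghost (Inl e)) = g (Ghost e)"
  "p \<in> F \<Longrightarrow> h (Edge (Inr p)) = M (Inr p)"
  "p \<in> F \<Longrightarrow> h (Ghost (Inr p)) = N (Inr p)"
  by (simp_all add: hs_image_def)

lemma hs_image_Inl: "v \<in> H \<union> S \<Longrightarrow> h (Vert (Inl v)) = q v"
  by (simp add: hs_image_simps mu_simps nu_simps gap_gap)

text \<open>All relations reduce to the orthonormality \<open>N_M\<close>.\<close>

lemma lpa_family_hs_image: "lpa_family G h"
proof -
  interpret G: wf_digraph G by (rule wf_G)
  show ?thesis
  proof
    fix x assume "x \<notin> lpa_gens G"
    then show "h x = 0" by (simp add: hs_image_def)
  next
    fix v w assume vw: "v \<in> verts G" "w \<in> verts G"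
    have "M v * (N v * M w) * N w = (if v = w then M v * N v else 0)"
      using vw by (simp add: N_M mult.assoc gap_nu[OF vrange_HS vrange_HS])
    then show "h (Vert v) * h (Vert w) = (if v = w then h (Vert v) else 0)"
      using vw by (simp add: hs_image_simps mult.assoc)
  next
    fix a assume a: "a \<in> arcs G"
    have *: "h (Vert (tail G a)) * h (Edge a) = h (Edge a) \<and> h (Ghost a) * h (Vert (tail G a)) = h (Ghost a)
       \<and> h (Edge a) * h (Vert (head G a)) = h (Edge a) \<and> h (Vert (head G a)) * h (Ghost a) = h (Ghost a)"
    proof (cases a)
      case (Inl e)
      then show ?thesis using a
        by (auto simp: hs_image_simps(2,3) hs_image_Inl gap_edge ghost_gap gap_H lpa_simps)
    next
      case (Inr p)
      then have p: "p \<in> F" "head E (last p) \<in> H \<union> S" using a F_last by (simp_all)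
      have 1: "N (Inr p) * M (Inr p) = q (head E (last p))"
        using N_M[of "Inr p" "Inr p"] p by (simp)
      show ?thesis
        unfolding Inr ends_G hs_image_simps(4,5)[OF p(1)] hs_image_Inl[OF p(2)]
        using p 1 by (simp add: hs_image_simps(1) mu_gap gap_nu mult.assoc)
          (simp add: gap_nu mult.assoc[symmetric])
    qed
    then show "h (Vert (tail G a)) * h (Edge a) = h (Edge a)" "h (Ghost a) * h (Vert (tail G a)) = h (Ghost a)"
      "h (Edge a) * h (Vert (head G a)) = h (Edge a)" "h (Vert (head G a)) * h (Ghost a) = h (Ghost a)"
      by auto
  next
    fix a b assume ab: "a \<in> arcs G" "b \<in> arcs G"
    show "h (Ghost a) * h (Edge b) = (if a = b then h (Vert (head G a)) else 0)"
    proof (cases a; cases b)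
      fix e f assume "a = Inl e" "b = Inl f"
      then show ?thesis using ab
        by (auto simp: hs_image_simps(2,3) hs_image_Inl gap_H lpa_simps)
    next
      fix p p' assume "a = Inr p" "b = Inr p'"
      then show ?thesis using ab N_M[of "Inr p" "Inr p'"]
        by (auto simp: hs_image_simps(4,5) hs_image_Inl[OF F_last])
    next
      fix e p assume ep: "a = Inl e" "b = Inr p"
      then obtain f p' where p: "p = f # p'" using ab by (cases p) (auto)
      \<comment> \<open>The old edge \<open>e\<close> runs from \<open>H \<union> S\<close> into
        \<open>H\<close>, which the first edge of a path in \<open>F\<close> never does.\<close>
      have "e \<noteq> f" using ab ep p F_hd_new[of p] by (auto)
      then show ?thesis using ab ep p
        by (simp add: hs_image_simps mu_simps lpa_simps)
    next
      fix e p assume ep: "a = Inr p" "b = Inl e"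
      then obtain f p' where p: "p = f # p'" using ab by (cases p) (auto)
      have "e \<noteq> f" using ab ep p F_hd_new[of p] by (auto)
      then show ?thesis using ab ep p
        by (simp add: hs_image_simps nu_simps lpa_simps mult.assoc)
    qed
  next
    fix w assume w: "regular_vertex G w"
    show "h (Vert w) = (\<Sum>a\<in>out_arcs G w. h (Edge a) * h (Ghost a))"
    proof (cases w)
      case (Inl v)
      then have v: "v \<in> H" "regular_vertex E v" using w by (simp_all add: regular_G)
      have "(\<Sum>e\<in>out_arcs E v. h (Edge (Inl e)) * h (Ghost (Inl e)))
          = (\<Sum>e\<in>out_arcs E v. g (Edge e) * g (Ghost e))"
        using v hereditaryD by (intro sum.cong) (auto simp: hs_image_simps(2,3))
      then show ?thesis
        using v by (simp add: Inl out_arcs_G sum.reindex hs_image_Inl gap_H regular_sum)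
    next
      case (Inr p)
      then have "p \<in> F" using w by (simp add: regular_vertex_def)
      then show ?thesis by (simp add: Inr out_arcs_G hs_image_simps)
    qed
  qed
qed

end

section \<open>The multiplication table between generators of \<open>E\<close> and new
  vertices\<close>

definition gen_products :: "('x \<Rightarrow> 'r::ring) \<Rightarrow> 'r set" where
  "gen_products l = {0} \<union> range l \<union> {l a * l b |a b. True}"

lemma gen_products_intros [intro!, simp]:
  "0 \<in> gen_products l" "l a \<in> gen_products l" "l a * l b \<in> gen_products l"
  by (auto simp: gen_products_def)

lemma left_action_products: "left_action E H S l x w \<in> gen_products l"
  by (cases x; cases w) auto

lemma left_action_map:
  assumes "\<And>a b. f (l a * l b) = f (l a) * f (l b)" "f 0 = 0"
  shows "f (left_action E H S l x w) = left_action E H S (\<lambda>a. f (l a)) x w"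
  by (cases x; cases w) (simp_all add: assms)

context hs_data
begin

text \<open>This dichotomy explains the two values of the table for an edge at an old vertex: the
  edge either survives in the new graph or is itself a new path of length one.\<close>

lemma arc_cases:
  assumes "e \<in> arcs E" "head E e \<in> H \<union> S"
  obtains "Inl e \<in> arcs G" "[e] \<notin> F" "head E e \<in> H" "tail E e \<in> H \<union> S"
  | "[e] \<in> F" "Inl e \<notin> arcs G"
  using assms S_not_H[of "head E e"] by (auto simp: F_single)

lemma not_old_arc: "e # p \<in> F \<Longrightarrow> Inl e \<notin> arcs G"
  using F_hd_new[of "e # p"] by auto

end

context hs_family
begin

lemma hs_image_outside: "x \<notin> lpa_gens G \<Longrightarrow> h x = 0"
  by (simp add: hs_image_def)

lemma vert_M: "w \<in> verts G \<Longrightarrow> g (Vert u) * M w = (if u = vsource E w then M w else 0)"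
  by (cases w) (auto simp: vert_mu)

lemma N_vert: "w \<in> verts G \<Longrightarrow> N w * g (Vert u) = (if u = vsource E w then N w else 0)"
  by (cases w) (auto simp: nu_vert)

lemma edge_M_0:
  assumes "w \<in> verts G" "head E e \<noteq> vsource E w"
  shows "g (Edge e) * M w = 0"
proof -
  have "g (Edge e) * M w = g (Edge e) * (g (Vert (head E e)) * M w)"
    by (simp add: edge_vert flip: mult.assoc)
  then show ?thesis by (simp only: vert_M[OF assms(1)] assms(2)) simp
qed

lemma N_ghost_0:
  assumes "w \<in> verts G" "head E e \<noteq> vsource E w"
  shows "N w * g (Ghost e) = 0"
proof -
  have "N w * g (Ghost e) = (N w * g (Vert (head E e))) * g (Ghost e)"
    by (simp add: vert_ghost mult.assoc)
  then show ?thesis by (simp only: N_vert[OF assms(1)] assms(2)) simp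
qed

lemma ghost_mu:
  assumes "admissible (f # p) v"
  shows "g (Ghost f) * mu (f # p) v = mu p v"
proof -
  note f = admissible_Cons[OF assms]
  have "g (Vert (head E f)) * mu p v = mu p v"
    unfolding vert_mu using f(3) by simp
  then show ?thesis using f(2) by (simp add: mu_simps lpa_simps)
qed

lemma nu_edge:
  assumes "admissible (f # p) v"
  shows "nu (f # p) v * g (Edge f) = nu p v"
proof -
  note f = admissible_Cons[OF assms]
  have "nu p v * g (Vert (head E f)) = nu p v"
    unfolding nu_vert using f(3) by simp
  then show ?thesis using f(2) by (simp add: nu_simps lpa_simps mult.assoc)
qed

text \<open>An edge is prepended to the path in \<open>M w\<close>, a ghost strips its first edge,
  and \<open>N w\<close> stays as it is; hence the entries of the form edge times ghost. Stripping a
  path of length one leaves a gap, which \<open>N w\<close> absorbs.\<close>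

lemma gen_hs_vertex:
  assumes w: "w \<in> verts G"
  shows "g x * h (Vert w) = left_action E H S h x w"
proof (cases x)
  case (Vert v)
  then show ?thesis using w
    by (cases w) (auto simp: hs_image_simps vert_mu simp flip: mult.assoc)
next
  case (Edge e)
  show ?thesis
  proof (cases "e \<in> arcs E \<and> head E e = vsource E w")
    case False
    then have "g (Edge e) * M w = 0"
      using edge_M_0[OF w, of e] by (auto simp: outside_arc)
    then show ?thesis using False w by (auto simp add: Edge hs_image_simps simp flip: mult.assoc)
  next
    case True
    show ?thesis
    proof (cases w)
      case (Inl v)
      then have v: "v = head E e" "head E e \<in> H \<union> S" using True w by auto
      show ?thesis
        using True v(2) w
        by (cases rule: arc_cases[OF conjunct1[OF True] v(2)])
          (auto simp: Edge Inl v(1) hs_image_Inl hs_image_simps(2-5) mu_simps gap_H edge_vert)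
    next
      case (Inr p)
      then have "e # p \<in> F" using True w by (cases "p = []") (auto simp: F_Cons)
      then show ?thesis
        using w True by (cases "p = []") (auto simp: Inr Edge hs_image_simps mu_simps mult.assoc)
    qed
  qed
next
  case (Ghost e)
  show ?thesis
  proof (cases w)
    case (Inl v)
    then show ?thesis
      using w outside_arc(2)[of e] hs_image_outside[of "Ghost (Inl e)"] hs_image_simps(3)[of e]
      by (cases "Inl e \<in> arcs G") (auto simp: Ghost hs_image_Inl ghost_gap)
  next
    case (Inr p)
    then obtain f p' where p: "p = f # p'" "p \<in> F" using w by (cases p) auto
    show ?thesis
    proof (cases "e = f")
      case True
      have adm: "admissible (f # p') (head E (last p))"
        using p F_last[OF p(2)] by (simp add: admissible_def)
      have "g (Ghost e) * (M w * N w) = mu p' (head E (last p)) * N w"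
        using ghost_mu[OF adm] by (simp add: True Inr p(1) flip: mult.assoc)
      moreover have "p' \<noteq> [] \<Longrightarrow> p' \<in> F" using p by (simp add: F_Cons)
      ultimately show ?thesis
        using w p F_last[of p]
        by (cases "p' = []") (auto simp: True Ghost Inr hs_image_simps mu_simps gap_nu)
    next
      case False
      then show ?thesis using w p
        by (simp add: Inr Ghost hs_image_simps mu_simps lpa_simps mult.assoc)
    qed
  qed
qed

text \<open>Right products only serve to show that the image is an ideal, so their shape is enough;
  the left products also define the action and need exact values.\<close>

lemma hs_vertex_gen:
  assumes w: "w \<in> verts G"
  shows "h (Vert w) * g x \<in> gen_products h"
proof (cases x)
  case (Vert v)
  then show ?thesis using w gen_products_intros(2)[of h "Vert w"]
    by (cases w) (auto simp: hs_image_simps nu_vert mult.assoc)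
next
  case (Ghost e)
  show ?thesis
  proof (cases "e \<in> arcs E \<and> head E e = vsource E w")
    case False
    then have "N w * g (Ghost e) = 0"
      using N_ghost_0[OF w, of e] by (auto simp: outside_arc)
    then show ?thesis using w by (simp add: Ghost hs_image_simps mult.assoc)
  next
    case True
    show ?thesis
    proof (cases w)
      case (Inl v)
      then have v: "v = head E e" "head E e \<in> H \<union> S" using True w by auto
      have "h (Vert w) * g (Ghost e) = h (Ghost (Inl e)) \<or> h (Vert w) * g (Ghost e) = h (Ghost (Inr [e]))"
        using True v(2) w
        by (cases rule: arc_cases[OF conjunct1[OF True] v(2)])
          (auto simp: Inl v(1) hs_image_Inl hs_image_simps(2-5) nu_simps gap_H vert_ghost)
      then show ?thesis using gen_products_intros(2)[of h] by (auto simp: Ghost)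
    next
      case (Inr p)
      then have "e # p \<in> F" using True w by (cases "p = []") (auto simp: F_Cons)
      then have "h (Vert w) * g (Ghost e) = h (Edge (Inr p)) * h (Ghost (Inr (e # p)))"
        using w True by (cases "p = []") (auto simp: Inr hs_image_simps nu_simps mult.assoc)
      then show ?thesis by (simp add: Ghost)
    qed
  qed
next
  case (Edge e)
  show ?thesis
  proof (cases w)
    case (Inl v)
    have "h (Vert w) * g (Edge e) = 0 \<or> h (Vert w) * g (Edge e) = h (Edge (Inl e))"
      using w Inl outside_arc(1)[of e] hs_image_simps(2)[of e]
      by (cases "Inl e \<in> arcs G") (auto simp: hs_image_Inl gap_edge)
    then show ?thesis using gen_products_intros(2)[of h] by (auto simp: Edge)
  next
    case (Inr p)
    then obtain f p' where p: "p = f # p'" "p \<in> F" using w by (cases p) auto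
    show ?thesis
    proof (cases "e = f")
      case True
      have adm: "admissible (f # p') (head E (last p))"
        using p F_last[OF p(2)] by (simp add: admissible_def)
      have "h (Vert w) * g (Edge e) = M w * (N w * g (Edge e))"
        using w by (simp add: hs_image_simps mult.assoc)
      also have "N w * g (Edge e) = nu p' (head E (last p))"
        using nu_edge[OF adm] by (simp add: True Inr p(1))
      finally have 1: "h (Vert w) * g (Edge e) = M w * nu p' (head E (last p))" .
      have "p' \<noteq> [] \<Longrightarrow> p' \<in> F" using p by (simp add: F_Cons)
      then have "h (Vert w) * g (Edge e) = h (Edge (Inr p)) \<or>
          h (Vert w) * g (Edge e) = h (Edge (Inr p)) * h (Ghost (Inr p'))"
        unfolding 1 using w p F_last[of p]
        by (cases "p' = []") (auto simp: Inr hs_image_simps nu_simps mu_gap)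
      then show ?thesis using gen_products_intros(2,3)[of h] by (auto simp: Edge)
    next
      case False
      then show ?thesis using w p
        by (simp add: Inr Edge hs_image_simps nu_simps lpa_simps mult.assoc)
    qed
  qed
qed

end

text \<open>The action in abstract form. \<open>Z\<close> is a left ideal containing the operators
  \<open>t x\<close> in which right multiplication by the vertices is jointly faithful, so
  identities between operators can be tested on vertices, where the table applies.\<close>

locale hs_action = hs_data E H S + G: lpa_family "hs_graph E H S" l
  for E :: "('v, 'e) pre_digraph" and H S :: "'v set"
    and l :: "('v + 'e list, 'e + 'e list) lpa_gen \<Rightarrow> 'r::ring" +
  fixes t :: "('v, 'e) lpa_gen \<Rightarrow> 'r" and Z :: "'r set"
  assumes action: "t x * l (Vert w) = left_action E H S l x w"
    and Z_diff: "a \<in> Z \<Longrightarrow> b \<in> Z \<Longrightarrow> a - b \<in> Z"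
    and Z_mult: "b \<in> Z \<Longrightarrow> a * b \<in> Z"
    and Z_gen: "t x \<in> Z"
    and separation: "z \<in> Z \<Longrightarrow> (\<And>w. z * l (Vert w) = 0) \<Longrightarrow> z = 0"
begin

lemma Z_0: "0 \<in> Z"
  using Z_mult[OF Z_gen, of 0] by simp

lemma Z_sum: "(\<And>i. i \<in> A \<Longrightarrow> a i \<in> Z) \<Longrightarrow> (\<Sum>i\<in>A. a i) \<in> Z"
proof (induction A rule: infinite_finite_induct)
  case (insert i A)
  then have "a i - (0 - (\<Sum>i\<in>A. a i)) \<in> Z" by (intro Z_diff Z_0) auto
  then show ?case using insert by simp
qed (simp_all add: Z_0)

lemma Z_eqI:
  assumes "a \<in> Z" "b \<in> Z" and eq: "\<And>w. w \<in> verts G \<Longrightarrow> a * l (Vert w) = b * l (Vert w)"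
  shows "a = b"
proof -
  have "a - b = 0"
  proof (rule separation)
    show "a - b \<in> Z" using assms by (intro Z_diff)
    show "(a - b) * l (Vert w) = 0" for w
      using eq[of w] G.outside[of "Vert w"] by (cases "w \<in> verts G") (simp_all add: left_diff_distrib)
  qed
  then show ?thesis by simp
qed

lemma t_outside: "x \<notin> lpa_gens E \<Longrightarrow> t x = 0"
proof (rule Z_eqI[OF Z_gen Z_0])
  fix w assume "x \<notin> lpa_gens E" "w \<in> verts G"
  then show "t x * l (Vert w) = 0 * l (Vert w)"
    using vsource_verts[of w] F_hd_arc G.outside_arc(2) by (cases x; cases w) (auto simp: action)
qed

lemma action_gen: "t x * l a = left_action E H S l x (gen_source G a) * l a"
  using action[of x "gen_source G a"] by (metis G.vert_gen mult.assoc)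

lemma action_gen_assoc: "t x * (l a * z) = left_action E H S l x (gen_source G a) * (l a * z)"
  using action_gen[of x a] by (metis mult.assoc)

text \<open>A new vertex emits exactly one edge, so its summation relation has a single
  term.\<close>

lemma new_edge_ghost: "p \<in> F \<Longrightarrow> l (Edge (Inr p)) * l (Ghost (Inr p)) = l (Vert (Inr p))"
  using G.regular_sum[of "Inr p"] by (simp add: regular_vertex_def out_arcs_G)

lemmas act = mult.assoc action action_gen action_gen_assoc G.lpa_simps

text \<open>Stripping \<open>e\<close> and prepending it again tests whether the path begins with
  \<open>e\<close>. This evaluates both the summation relations and the gaps on new
  vertices.\<close>

lemma edge_ghost_action:
  assumes p: "p \<in> F"
  shows "t (Edge e) * (t (Ghost e) * l (Vert (Inr p))) = (if e = hd p then l (Vert (Inr p)) else 0)"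
proof (cases p)
  case (Cons f p')
  show ?thesis
    using p F_last[OF p] F_hd_arc[OF p] not_old_arc[of f p'] new_edge_ghost[OF p]
    by (cases "p' = []") (auto simp: Cons act F_Cons)
qed (use p in simp)

lemma lpa_family_action: "lpa_family E t"
proof
  fix x assume "x \<notin> lpa_gens E"
  then show "t x = 0" by (rule t_outside)
next
  fix v u
  show "t (Vert v) * t (Vert u) = (if v = u then t (Vert v) else 0)"
    by (rule Z_eqI) (auto simp: Z_0 Z_gen Z_mult act)
next
  fix e assume e: "e \<in> arcs E"
  show "t (Vert (tail E e)) * t (Edge e) = t (Edge e)"
  proof (rule Z_eqI)
    fix w assume w: "w \<in> verts G"
    show "t (Vert (tail E e)) * t (Edge e) * l (Vert w) = t (Edge e) * l (Vert w)"
    proof (cases w)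
      case (Inl v)
      show ?thesis
      proof (cases "v = head E e")
        case True
        then have "head E e \<in> H \<union> S" using w Inl by auto
        then show ?thesis using w e True by (cases rule: arc_cases[OF e]) (auto simp: Inl act)
      qed (use w in \<open>auto simp: Inl act\<close>)
    next
      case (Inr p)
      then show ?thesis using w e by (cases "p = []") (auto simp: act F_Cons)
    qed
  qed (simp_all add: Z_gen Z_mult)
  show "t (Edge e) * t (Vert (head E e)) = t (Edge e)"
    by (rule Z_eqI) (auto simp: Z_gen Z_mult act split: sum.splits)
  show "t (Vert (head E e)) * t (Ghost e) = t (Ghost e)"
  proof (rule Z_eqI)
    fix w assume w: "w \<in> verts G"
    show "t (Vert (head E e)) * t (Ghost e) * l (Vert w) = t (Ghost e) * l (Vert w)"
    proof (cases w)
      case (Inl v)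
      show ?thesis
        using w G.outside_arc(2)[of "Inl e"] by (cases "Inl e \<in> arcs G") (auto simp: Inl act)
    next
      case (Inr p)
      then obtain f p' where p: "p = f # p'" "p \<in> F" using w by (cases p) auto
      then show ?thesis using F_last[of p] by (cases "p' = []") (auto simp: Inr act F_Cons)
    qed
  qed (simp_all add: Z_gen Z_mult)
  show "t (Ghost e) * t (Vert (tail E e)) = t (Ghost e)"
    by (rule Z_eqI) (auto simp: Z_gen Z_mult act split: sum.splits)
next
  fix e f assume e: "e \<in> arcs E" and f: "f \<in> arcs E"
  show "t (Ghost e) * t (Edge f) = (if e = f then t (Vert (head E e)) else 0)"
  proof (rule Z_eqI)
    fix w assume w: "w \<in> verts G"
    show "t (Ghost e) * t (Edge f) * l (Vert w) = (if e = f then t (Vert (head E e)) else 0) * l (Vert w)"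
    proof (cases w)
      case (Inl v)
      show ?thesis
      proof (cases "v = head E f")
        case True
        then have "head E f \<in> H \<union> S" using w Inl by auto
        then show ?thesis using w e f True
          by (cases rule: arc_cases[OF f]) (auto simp: Inl act G.outside_arc)
      qed (use w in \<open>auto simp: Inl act\<close>)
    next
      case (Inr p)
      then show ?thesis using w e f by (cases "p = []") (auto simp: act F_Cons new_edge_ghost)
    qed
  qed (auto simp add: Z_gen Z_mult Z_0)
next
  fix v assume v: "regular_vertex E v"
  show "t (Vert v) = (\<Sum>e\<in>out_arcs E v. t (Edge e) * t (Ghost e))"
  proof (rule Z_eqI)
    fix w assume w: "w \<in> verts G"
    have 1: "(\<Sum>e\<in>out_arcs E v. t (Edge e) * t (Ghost e)) * l (Vert w)
        = (\<Sum>e\<in>out_arcs E v. t (Edge e) * (t (Ghost e) * l (Vert w)))"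
      by (simp add: sum_distrib_right mult.assoc)
    show "t (Vert v) * l (Vert w) = (\<Sum>e\<in>out_arcs E v. t (Edge e) * t (Ghost e)) * l (Vert w)"
    proof (cases w)
      case (Inl u)
      show ?thesis
      proof (cases "u = v")
        case False
        then have "(\<Sum>e\<in>out_arcs E v. t (Edge e) * (t (Ghost e) * l (Vert w))) = 0"
          by (intro sum.neutral) (auto simp: Inl act)
        then show ?thesis unfolding 1 using False by (simp add: Inl action)
      next
        case True
        \<comment> \<open>A vertex of \<open>S\<close> emits infinitely many edges, so a regular old
          vertex lies in \<open>H\<close>, where the new graph has the same outgoing edges as
          \<open>E\<close>.\<close>
        have "v \<in> H" using w v breaking
          by (auto simp: Inl True regular_vertex_def breaking_vertices_def)
        have "(\<Sum>e\<in>out_arcs E v. t (Edge e) * (t (Ghost e) * l (Vert w)))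
            = (\<Sum>e\<in>out_arcs E v. l (Edge (Inl e)) * l (Ghost (Inl e)))"
          using hereditaryD \<open>v \<in> H\<close> by (intro sum.cong) (auto simp: Inl True act)
        also have "\<dots> = l (Vert (Inl v))"
          using v \<open>v \<in> H\<close> by (simp add: G.regular_sum regular_G out_arcs_G sum.reindex)
        finally show ?thesis unfolding 1 using w by (simp add: Inl True action)
      qed
    next
      case (Inr p)
      then obtain f p' where p: "p = f # p'" "p \<in> F" using w by (cases p) auto
      have "t (Edge e) * (t (Ghost e) * l (Vert w)) = (if e = f then l (Vert w) else 0)" for e
        using edge_ghost_action[OF p(2), of e] p(1) by (simp add: Inr)
      then have "(\<Sum>e\<in>out_arcs E v. t (Edge e) * (t (Ghost e) * l (Vert w)))
          = (\<Sum>e\<in>out_arcs E v. if e = f then l (Vert w) else 0)"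
        by (intro sum.cong) auto
      also have "\<dots> = (if tail E f = v then l (Vert w) else 0)"
        using v F_hd_arc[OF p(2)] p(1) by (auto simp: regular_vertex_def)
      finally show ?thesis unfolding 1 using p by (simp add: Inr action)
    qed
  qed (simp_all add: Z_gen Z_mult Z_sum)
qed

sublocale T: hs_family E H S t
  by (intro hs_family.intro hs_data_axioms lpa_family_action)

text \<open>At a new vertex whose path starts at \<open>v\<close>, the first edge ends outside
  \<open>H\<close>, so the subtracted sum contains exactly the term that cancels the action of
  \<open>v\<close>. At an old vertex every subtracted term is 0, since those edges are not in the
  new graph.\<close>

lemma gap_action:
  assumes v: "v \<in> H \<union> S" and w: "w \<in> verts G"
  shows "T.q v * l (Vert w) = (if w = Inl v then l (Vert w) else 0)"
proof -
  have 1: "T.q v * l (Vert w) = t (Vert v) * l (Vert w)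
      - (\<Sum>e\<in>outside_arcs E H v. t (Edge e) * (t (Ghost e) * l (Vert w)))"
    by (simp add: gap_def left_diff_distrib sum_distrib_right mult.assoc)
  show ?thesis
  proof (cases w)
    case (Inl u)
    have "(\<Sum>e\<in>outside_arcs E H v. t (Edge e) * (t (Ghost e) * l (Vert w))) = 0"
      using G.outside_arc(2) by (intro sum.neutral) (auto simp: Inl act outside_arcs_def)
    then show ?thesis unfolding 1 using w by (auto simp: Inl action)
  next
    case (Inr p)
    then have p: "p \<in> F" using w by simp
    then obtain f p' where fp: "p = f # p'" by (cases p) auto
    have "t (Edge e) * (t (Ghost e) * l (Vert w)) = (if e = f then l (Vert w) else 0)" for e
      using edge_ghost_action[OF p, of e] fp by (simp add: Inr)
    then have "(\<Sum>e\<in>outside_arcs E H v. t (Edge e) * (t (Ghost e) * l (Vert w)))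
        = (if f \<in> outside_arcs E H v then l (Vert w) else 0)"
      using finite_outside_arcs[OF v] by simp
    also have "\<dots> = (if tail E f = v then l (Vert w) else 0)"
      using v F_hd_arc[OF p] F_hd_new[OF p] fp by (auto simp: outside_arcs_def)
    finally show ?thesis unfolding 1 using p fp by (auto simp: Inr action)
  qed
qed

text \<open>The edges act from the last to the first: the last one turns the range vertex into a new
  edge, and each further one extends the path labelling that edge.\<close>

lemma path_gap_action:
  "p \<in> F \<Longrightarrow> T.mu p (head E (last p)) * l (Vert (Inl (head E (last p)))) = l (Edge (Inr p))"
proof (induction p)
  case (Cons e p)
  show ?case
  proof (cases "p = []")
    case True
    then have e: "e \<in> arcs E" "head E e \<in> H \<union> S" "Inl e \<notin> arcs G"
      using Cons.prems F_hd_arc[OF Cons.prems] F_last[OF Cons.prems] not_old_arc[of e p] by auto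
    have "T.q (head E e) * l (Vert (Inl (head E e))) = l (Vert (Inl (head E e)))"
      using gap_action[of "head E e" "Inl (head E e)"] e by simp
    then show ?thesis using True e by (auto simp add: T.mu_simps act)
  next
    case False
    then have p: "p \<in> F" "e \<in> arcs E" "head E e = tail E (hd p)" using Cons.prems by (simp_all add: F_Cons)
    have "t (Edge e) * l (Edge (Inr p)) = l (Edge (Inr (e # p))) * (l (Ghost (Inr p)) * l (Edge (Inr p)))"
      using p by (simp add: action_gen mult.assoc)
    also have "\<dots> = l (Edge (Inr (e # p)))"
      using False p by (simp add: G.lpa_simps)
    finally show ?thesis
      using Cons.IH[OF p(1)] False by (simp add: T.mu_simps mult.assoc)
  qed
qed simp

text \<open>For a ghost generator write the vertex \<open>w\<close> as \<open>T.M w * k\<close> and apply \<open>T.N_M\<close>.\<close>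

lemma hs_image_action: "hs_image E H S t x * l (Vert w) = l x * l (Vert w)"
proof (cases "x \<in> lpa_gens G \<and> w \<in> verts G")
  case False
  then show ?thesis
    using G.outside[of x] G.outside[of "Vert w"] by (auto simp: hs_image_def)
next
  case True
  then have x: "x \<in> lpa_gens G" and w: "w \<in> verts G" by auto
  \<comment> \<open>The path operator absorbs the gap at its end, and that gap acts as the
    projection onto the range vertex.\<close>
  have M: "T.M (Inr p) * l (Vert u) = l (Edge (Inr p)) * l (Vert u)"
    if p: "p \<in> F" and u: "u \<in> verts G" for p u
  proof -
    have "T.M (Inr p) * l (Vert u) = T.mu p (head E (last p)) * (T.q (head E (last p)) * l (Vert u))"
      using p F_last[OF p] by (simp add: T.mu_gap flip: mult.assoc)
    also have "T.q (head E (last p)) * l (Vert u) = (if u = Inl (head E (last p)) then l (Vert u) else 0)"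
      by (rule gap_action[OF F_last[OF p] u])
    finally show ?thesis using path_gap_action[OF p] by (auto simp: G.lpa_simps)
  qed
  have M_ghost: "T.M (Inr p) * l (Ghost (Inr p)) = l (Vert (Inr p))" if p: "p \<in> F" for p
  proof -
    have "T.M (Inr p) * l (Ghost (Inr p))
        = (T.M (Inr p) * l (Vert (Inl (head E (last p))))) * l (Ghost (Inr p))"
      by (simp add: G.lpa_simps mult.assoc)
    then show ?thesis
      using M[OF p, of "Inl (head E (last p))"] F_last[OF p] new_edge_ghost[OF p]
      by (simp add: G.lpa_simps)
  qed
  have N: "T.N (Inr p) * l (Vert w) = l (Ghost (Inr p)) * l (Vert w)" if p: "p \<in> F" for p
  proof (cases w)
    case (Inl v)
    then have v: "v \<in> H \<union> S" using w by simp
    have "T.N (Inr p) * l (Vert w) = T.N (Inr p) * T.M w * l (Vert w)"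
      using gap_action[OF v w] by (simp add: Inl T.mu_simps mult.assoc)
    also have "\<dots> = 0"
      using T.N_M[of "Inr p" w] p w by (simp add: Inl)
    finally show ?thesis by (simp add: Inl G.lpa_simps)
  next
    case (Inr p')
    then have p': "p' \<in> F" using w by simp
    have "T.N (Inr p) * l (Vert w) = T.N (Inr p) * T.M w * l (Ghost (Inr p'))"
      using M_ghost[OF p'] by (simp add: Inr mult.assoc)
    also have "\<dots> = (if p = p' then T.q (head E (last p)) * l (Ghost (Inr p')) else 0)"
      using T.N_M[of "Inr p" w] p w by (simp add: Inr)
    also have "T.q (head E (last p)) * l (Ghost (Inr p)) = l (Ghost (Inr p))"
    proof -
      have "T.q (head E (last p)) * l (Ghost (Inr p))
          = T.q (head E (last p)) * l (Vert (Inl (head E (last p)))) * l (Ghost (Inr p))"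
        by (simp add: G.lpa_simps mult.assoc)
      then show ?thesis
        using gap_action[OF F_last[OF p], of "Inl (head E (last p))"] F_last[OF p]
        by (simp add: G.lpa_simps)
    qed
    then have "(if p = p' then T.q (head E (last p)) * l (Ghost (Inr p')) else 0)
        = l (Ghost (Inr p)) * l (Vert w)"
      by (auto simp: Inr G.lpa_simps)
    finally show ?thesis .
  qed
  show ?thesis
  proof (cases x)
    case (Vert u)
    then have u: "u \<in> verts G" using x by simp
    show ?thesis
    proof (cases u)
      case (Inl v)
      then show ?thesis using gap_action[of v w] u w by (auto simp: Vert T.hs_image_Inl G.lpa_simps)
    next
      case (Inr p)
      then have p: "p \<in> F" using u by simp
      have "T.h x * l (Vert w) = T.M (Inr p) * (l (Ghost (Inr p)) * l (Vert w))"
        using N[OF p] p by (simp add: Vert Inr T.hs_image_simps mult.assoc)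
      then show ?thesis using M_ghost[OF p] by (simp add: Vert Inr flip: mult.assoc)
    qed
  next
    case (Edge a)
    show ?thesis
    proof (cases a)
      case (Inl e)
      then have e: "Inl e \<in> arcs G" using x Edge by simp
      \<comment> \<open>An old edge ends in \<open>H\<close>, whereas a path in \<open>F\<close>
        starts outside \<open>H\<close>; so both sides vanish at new vertices.\<close>
      then have "w = Inr p \<Longrightarrow> head E e \<noteq> tail E (hd p)" for p using w F_hd_not_H[of p] by auto
      then show ?thesis using e w
        by (cases w) (auto simp: Edge Inl T.hs_image_simps(2) act)
    next
      case (Inr p)
      then show ?thesis using M[of p w] x w by (simp add: Edge T.hs_image_simps)
    qed
  next
    case (Ghost a)
    show ?thesis
    proof (cases a)
      case (Inl e)
      then have e: "Inl e \<in> arcs G" using x Ghost by simp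
      then have "w = Inr p \<Longrightarrow> hd p \<noteq> e" for p using w F_hd_new[of p] by auto
      then show ?thesis using e w
        by (cases w) (auto simp: Ghost Inl T.hs_image_simps(3) act)
    next
      case (Inr p)
      then show ?thesis using N[of p] x by (simp add: Ghost T.hs_image_simps)
    qed
  qed
qed

end

section \<open>The action of \<open>L(E)\<close> on the new Leavitt path algebra\<close>

text \<open>The table sees a word only through the source of its first letter. On elements with a
  single such source, \<open>translate\<close> is an honest left multiplication.\<close>

definition left_homogeneous :: "('v, 'e) pre_digraph \<Rightarrow> 'v \<Rightarrow> (('v, 'e) lpa_gen word \<Rightarrow>\<^sub>0 'k::field) \<Rightarrow> bool" where
  "left_homogeneous E v p \<longleftrightarrow>
     (\<forall>w\<in>Poly_Mapping.keys p. letters w \<noteq> [] \<and> gen_source E (hd (letters w)) = v)"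

lemma left_homogeneous_0: "left_homogeneous E v 0"
  by (simp add: left_homogeneous_def)

lemma left_homogeneous_gen: "left_homogeneous E v (gen x) \<longleftrightarrow> v = gen_source E x"
  by (auto simp: left_homogeneous_def)

lemma left_homogeneous_diff:
  "left_homogeneous E v p \<Longrightarrow> left_homogeneous E v q \<Longrightarrow> left_homogeneous E v (p - q)"
  unfolding left_homogeneous_def using keys_diff[of p q] by blast

lemma left_homogeneous_sum:
  "(\<And>i. i \<in> A \<Longrightarrow> left_homogeneous E v (p i)) \<Longrightarrow> left_homogeneous E v (\<Sum>i\<in>A. p i)"
  unfolding left_homogeneous_def using keys_sum[of p A] by blast

lemma left_homogeneous_mult: "left_homogeneous E v p \<Longrightarrow> left_homogeneous E v (p * q)"
  unfolding left_homogeneous_def using keys_mult[of p q] by (fastforce simp: plus_word_def)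

lemma left_homogeneous_const: "left_homogeneous E v p \<Longrightarrow> left_homogeneous E v (const c * p)"
  using left_homogeneous_mult[of E v p "const c"] by (simp add: const_commute)

lemma relator_left_homogeneous:
  assumes "r \<in> lpa_relators E"
  shows "\<exists>v. left_homogeneous E v r"
proof -
  have *: "gen_source E x = v \<Longrightarrow> left_homogeneous E v (gen x * p)" for v x p
    by (simp add: left_homogeneous_mult left_homogeneous_gen)
  note rules = * left_homogeneous_gen left_homogeneous_0
  from assms consider
      x where "r = gen x"
    | v w where "r = gen (Vert v) * gen (Vert w) - (if v = w then gen (Vert v) else 0)"
    | e where "r = gen (Vert (tail E e)) * gen (Edge e) - gen (Edge e)"
    | e where "r = gen (Edge e) * gen (Vert (head E e)) - gen (Edge e)"
    | e where "r = gen (Vert (head E e)) * gen (Ghost e) - gen (Ghost e)"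
    | e where "r = gen (Ghost e) * gen (Vert (tail E e)) - gen (Ghost e)"
    | e f where "r = gen (Ghost e) * gen (Edge f) - (if e = f then gen (Vert (head E e)) else 0)"
    | v where "r = gen (Vert v) - (\<Sum>e\<in>out_arcs E v. gen (Edge e) * gen (Ghost e))"
    unfolding lpa_relators_def lpa_relations_def by blast
  then show ?thesis
  proof cases
    case (1 x)
    then show ?thesis by (simp add: left_homogeneous_gen)
  next
    case (2 v w)
    then show ?thesis by (intro exI[of _ v]) (auto intro!: left_homogeneous_diff simp: rules)
  next
    case (3 e)
    then show ?thesis by (intro exI[of _ "tail E e"]) (auto intro!: left_homogeneous_diff simp: rules)
  next
    case (4 e)
    then show ?thesis by (intro exI[of _ "tail E e"]) (auto intro!: left_homogeneous_diff simp: rules)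
  next
    case (5 e)
    then show ?thesis by (intro exI[of _ "head E e"]) (auto intro!: left_homogeneous_diff simp: rules)
  next
    case (6 e)
    then show ?thesis by (intro exI[of _ "head E e"]) (auto intro!: left_homogeneous_diff simp: rules)
  next
    case (7 e f)
    then show ?thesis by (intro exI[of _ "head E e"]) (auto intro!: left_homogeneous_diff simp: rules)
  next
    case (8 v)
    then show ?thesis
      by (intro exI[of _ v]) (auto intro!: left_homogeneous_diff left_homogeneous_sum simp: rules)
  qed
qed

context hs_data
begin

text \<open>A word is fixed by the source of its first letter, so that vertex is inserted in front
  and multiplied according to the table. Constants have no first letter and are sent to 0.\<close>

definition translate :: "('v, 'e) lpa_gen \<Rightarrow> (('v + 'e list, 'e + 'e list) lpa_gen word \<Rightarrow>\<^sub>0 'k::field)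
    \<Rightarrow> (('v + 'e list, 'e + 'e list) lpa_gen word \<Rightarrow>\<^sub>0 'k)" where
  "translate x = linear_extension (\<lambda>w c. case letters w of [] \<Rightarrow> 0
     | a # _ \<Rightarrow> left_action E H S gen x (gen_source G a) * Poly_Mapping.single w c)"

lemma translate_add: "translate x (p + q) = translate x p + translate x q"
  unfolding translate_def
  by (rule linear_extension_add) (auto simp: single_add distrib_left split: list.splits)

lemma translate_homogeneous:
  assumes "left_homogeneous G v p"
  shows "translate x p = left_action E H S gen x v * p"
proof -
  have "translate x p = (\<Sum>w\<in>Poly_Mapping.keys p.
      left_action E H S gen x v * Poly_Mapping.single w (Poly_Mapping.lookup p w))"
    unfolding translate_def linear_extension_def using assms
    by (intro sum.cong) (auto simp: left_homogeneous_def split: list.splits)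
  then show ?thesis by (simp add: sum_single_keys flip: sum_distrib_left)
qed

lemma translate_gen: "translate x (gen a * p) = left_action E H S gen x (gen_source G a) * (gen a * p)"
  by (rule translate_homogeneous) (simp add: left_homogeneous_mult left_homogeneous_gen)

lemma translate_0: "translate x 0 = 0"
  using translate_add[of x 0 0] by simp

lemma translate_const: "translate x (const c) = 0"
  unfolding translate_def by (subst linear_extension_single) simp_all

lemma word_cases:
  obtains "w = 0" | x xs where "w = Word (x # xs)"
  by (metis word.exhaust word_Nil neq_Nil_conv)

lemma translate_scale: "translate x (const c * p) = const c * translate x p"
proof (induction p rule: npoly_induct)
  case (single w d)
  show ?case
  proof (cases w rule: word_cases)
    case 1
    then show ?thesis using translate_const[of x "c * d"] by (simp add: mult_single translate_const)
  next
    case (2 a xs)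
    have h: "left_homogeneous G (gen_source G a) (Poly_Mapping.single w d)"
      by (simp add: left_homogeneous_def 2)
    show ?thesis
      unfolding translate_homogeneous[OF left_homogeneous_const[OF h]] translate_homogeneous[OF h]
      by (simp only: const_commute[of c] mult.assoc)
  qed
qed (simp_all add: translate_0 translate_add distrib_left)

text \<open>For a word \<open>w\<close>, the product of its monomial with \<open>r * b\<close> has a
  single source: that of the first letter of \<open>w\<close>, or that of the relator
  \<open>r\<close> if \<open>w\<close> is empty. There \<open>translate\<close> is a left
  multiplication and keeps the ideal.\<close>

lemma translate_ideal: "j \<in> lpa_ideal G \<Longrightarrow> translate x j \<in> lpa_ideal G"
proof (induction rule: two_sided_ideal.induct)
  case (add r y a b)
  from relator_left_homogeneous[OF add(1)] obtain v where v: "left_homogeneous G v r" ..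
  have "translate x (a * r * b) \<in> lpa_ideal G"
  proof (induction a rule: npoly_induct)
    case (single w c)
    have "\<exists>u. left_homogeneous G u (Poly_Mapping.single w c * (r * b))"
    proof (cases w rule: word_cases)
      case 1
      then show ?thesis using v by (auto intro: left_homogeneous_const left_homogeneous_mult)
    next
      case (2 a xs)
      then have "left_homogeneous G (gen_source G a) (Poly_Mapping.single w c)"
        by (simp add: left_homogeneous_def)
      then show ?thesis by (auto intro: left_homogeneous_mult)
    qed
    then obtain u where "left_homogeneous G u (Poly_Mapping.single w c * (r * b))" ..
    then show ?case
      using two_sided_ideal_mult_right[OF two_sided_ideal_incl[OF add(1)]]
      by (simp add: translate_homogeneous mult.assoc two_sided_ideal_mult_left)
  qed (auto simp: translate_0 translate_add distrib_right intro: two_sided_ideal.zero two_sided_ideal_add)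
  then show ?case using add by (simp add: translate_add two_sided_ideal_add)
qed (simp add: translate_0 two_sided_ideal.zero)

definition translation where
  "translation x = Endo (translate x)"

lemma app_translation: "app (translation x) p = translate x p"
  unfolding translation_def by (subst Endo_inverse) (simp_all add: translate_add)

end

lemma hs_image_ring_map:
  assumes f: "ring_map f"
  shows "f (hs_image E H S g y) = hs_image E H S (\<lambda>x. f (g x)) y"
proof -
  note f_simps = ring_map_mult[OF f] ring_map_0[OF f] ring_map_diff[OF f] ring_map_sum[OF f]
  have gap: "f (gap E H g v) = gap E H (\<lambda>x. f (g x)) v" for v
    by (simp add: gap_def f_simps)
  have 1: "f (path_gap E H g p v) = path_gap E H (\<lambda>x. f (g x)) p v" for p v
    by (induction p) (simp_all add: path_gap_def gap f_simps)
  have 2: "f (gap_path E H g p v) = gap_path E H (\<lambda>x. f (g x)) p v" for p v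
    by (induction p) (simp_all add: gap_path_def gap f_simps)
  show ?thesis
    by (simp add: hs_image_def f_simps 1 2 split: lpa_gen.split sum.split)
qed

lemma (in quotient_projection) left_mult_const_rep: "left_mult (const c) * rep q = rep (const c * q)"
  by (rule endo_eqI) (simp add: app_simps app_rep linear mult.assoc)

locale hs_projection = hs_data E H S + Q: quotient_projection "lpa_relators (hs_graph E H S)" P
  for E :: "('v, 'e) pre_digraph" and H S :: "'v set"
    and P :: "(('v + 'e list, 'e + 'e list) lpa_gen word \<Rightarrow>\<^sub>0 'k::field) endo"
begin

abbreviation "l \<equiv> \<lambda>a. Q.rep (gen a)"

definition "t x = P * translation x"

text \<open>Operators that factor through the quotient and kill constants are determined by their
  values on nonempty words. Each such word is fixed, modulo the ideal, by the source of its first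
  letter, which gives \<open>separation\<close>.\<close>

definition "Z = {z. z * P = z \<and> (\<forall>c. app z (const c) = 0)}"

lemma lpa_family_l: "lpa_family G l"
  unfolding lpa_family_iff_relators[OF wf_G Q.ring_map_rep]
  by (auto simp: Q.rep_eq_0_iff intro: two_sided_ideal_incl)

lemma t_P: "t x * P = t x"
proof (rule endo_eqI)
  fix p
  have "app P (translate x (p - app P p)) = 0"
    using translate_ideal[OF Q.residue] by (simp add: Q.kernel)
  moreover have "translate x (p - app P p) = translate x p - translate x (app P p)"
    unfolding app_translation[symmetric] by (rule app_diff)
  ultimately show "app (t x * P) p = app (t x) p"
    by (simp add: t_def app_simps app_translation app_diff)
qed

lemma app_t: "app (t x) p = app P (translate x p)"
  by (simp add: t_def app_simps app_translation)

sublocale hs_action E H S l t Z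
proof (intro hs_action.intro hs_data_axioms lpa_family_l hs_action_axioms.intro)
  interpret G: lpa_family G l by (rule lpa_family_l)
  fix x w
  let ?A = "left_action E H S gen x w"
  have "t x * l (Vert w) = Q.rep (?A * gen (Vert w))"
  proof (rule endo_eqI)
    fix n
    have "app (t x * l (Vert w)) n = app (t x * P) (gen (Vert w) * n)"
      by (simp add: app_simps Q.app_rep)
    also have "\<dots> = app P (?A * (gen (Vert w) * n))"
      by (simp add: t_P app_t translate_gen)
    finally show "app (t x * l (Vert w)) n = app (Q.rep (?A * gen (Vert w))) n"
      by (simp add: Q.app_rep mult.assoc)
  qed
  also have "\<dots> = left_action E H S l x w * l (Vert w)"
    using left_action_map[of Q.rep gen] ring_map_mult[OF Q.ring_map_rep] ring_map_0[OF Q.ring_map_rep]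
    by metis
  \<comment> \<open>Every nonzero table entry already ends at \<open>w\<close>, so it absorbs the
    vertex on its right.\<close>
  also have "\<dots> = left_action E H S l x w"
    by (cases x; cases w) (auto simp: mult.assoc G.lpa_simps)
  finally show "t x * l (Vert w) = left_action E H S l x w" .
next
  show "a - b \<in> Z" if "a \<in> Z" "b \<in> Z" for a b
    using that by (auto simp: Z_def left_diff_distrib app_simps)
  show "a * b \<in> Z" if "b \<in> Z" for a b
    using that by (auto simp: Z_def mult.assoc app_simps)
  show "t x \<in> Z" for x
    by (simp add: Z_def t_P app_t translate_const)
  fix z assume z: "z \<in> Z" and zero: "\<And>w. z * l (Vert w) = 0"
  have l: "z * l a = 0" for a
  proof -
    have "z * l a = z * l (Vert (gen_source G a)) * l a"
      by (simp add: lpa_family.vert_gen[OF lpa_family_l] mult.assoc)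
    then show ?thesis by (simp add: zero)
  qed
  have zP: "app z (app P n) = app z n" for n
    using z by (metis (mono_tags, lifting) Z_def mem_Collect_eq times_endo.rep_eq)
  have "app z n = 0" for n
  proof (induction n rule: npoly_induct)
    case (single w c)
    show ?case
    proof (cases w rule: word_cases)
      case 1
      then show ?thesis using z by (simp add: Z_def)
    next
      case (2 a xs)
      have "app (z * l a) (Poly_Mapping.single (Word xs) c) = 0" by (simp add: l app_simps)
      then show ?thesis by (simp add: 2 single_Cons app_simps Q.app_rep zP)
    qed
  qed (simp_all add: app_add)
  then show "z = 0" by (intro endo_eqI) (simp add: app_simps)
qed

sublocale eval_t: evaluation "\<lambda>c. left_mult (const c)" t
proof
  show "left_mult (const c) * t x = t x * left_mult (const c)" for c x
    by (rule endo_eqI) (simp add: app_simps app_t translate_scale Q.linear)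
qed (auto intro!: endo_eqI simp: app_simps single_add distrib_right mult_single simp flip: mult.assoc)

text \<open>The ranges of the last letters suffice. Asking for all finite supersets lets two
  summands share the union of their sets.\<close>

lemma exists_local_unit:
  assumes "p \<in> lpa_carrier G"
  shows "\<exists>W. finite W \<and> (\<forall>W'. finite W' \<longrightarrow> W \<subseteq> W' \<longrightarrow> Q.rep p * (\<Sum>w\<in>W'. l (Vert w)) = Q.rep p)"
  using assms
proof (induction rule: poly_carrier_induct)
  case zero
  then show ?case by (intro exI[of _ "{}"]) (simp add: ring_map_0[OF Q.ring_map_rep])
next
  case (gen x c)
  have "Q.rep (const c * gen x) * (\<Sum>w\<in>W'. l (Vert w)) = Q.rep (const c * gen x)"
    if "finite W'" "gen_range G x \<in> W'" for W'
    using that by (simp add: ring_map_mult[OF Q.ring_map_rep] sum_distrib_left mult.assoc G.gen_vert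
        if_distrib cong: if_cong)
  then show ?case by (intro exI[of _ "{gen_range G x}"]) auto
next
  case (Cons x xs c)
  then show ?case by (auto simp: ring_map_mult[OF Q.ring_map_rep] mult.assoc)
next
  case (add p q)
  then obtain A B where "finite A" "finite B"
    "\<And>W'. finite W' \<Longrightarrow> A \<subseteq> W' \<Longrightarrow> Q.rep p * (\<Sum>w\<in>W'. l (Vert w)) = Q.rep p"
    "\<And>W'. finite W' \<Longrightarrow> B \<subseteq> W' \<Longrightarrow> Q.rep q * (\<Sum>w\<in>W'. l (Vert w)) = Q.rep q"
    by blast
  then show ?case
    by (intro exI[of _ "A \<union> B"]) (simp add: ring_map_add[OF Q.ring_map_rep] distrib_right)
qed

interpretation image: evaluation const "hs_image E H S gen :: _ \<Rightarrow> ('v, 'e) lpa_gen word \<Rightarrow>\<^sub>0 'k"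
  by (rule evaluation_const)

lemma eval_t_image:
  assumes "p \<in> lpa_carrier G"
  shows "eval_t.eval (image.eval p) * l (Vert w) = Q.rep p * l (Vert w)"
proof -
  have h: "eval_t.eval (hs_image E H S gen x) = hs_image E H S t x" for x
    by (simp add: hs_image_ring_map[OF eval_t.ring_map_eval])
  show ?thesis
    using assms
  proof (induction arbitrary: w rule: poly_carrier_induct)
    case zero
    then show ?case by (simp add: image.eval_0 eval_t.eval_0 ring_map_0[OF Q.ring_map_rep])
  next
    case (gen x c)
    have "eval_t.eval (image.eval (const c * gen x)) * l (Vert w) = left_mult (const c) * (l x * l (Vert w))"
      by (simp add: image.eval_mult eval_t.eval_mult h mult.assoc hs_image_action)
    then show ?case by (simp add: Q.left_mult_const_rep flip: mult.assoc)
  next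
    case (Cons x xs c)
    let ?s = "Poly_Mapping.single (Word xs) c"
    obtain a ys where xs: "xs = a # ys" using Cons(2) by (cases xs) auto
    \<comment> \<open>The image of \<open>x\<close> is known only on vertices, so the source of the
      next letter is inserted between \<open>x\<close> and the remaining word.\<close>
    have s: "Q.rep ?s = l (Vert (gen_source G a)) * Q.rep ?s"
      by (simp add: xs single_Cons ring_map_mult[OF Q.ring_map_rep] G.vert_gen flip: mult.assoc)
    have "eval_t.eval (image.eval (gen x * ?s)) * l (Vert w) = hs_image E H S t x * (Q.rep ?s * l (Vert w))"
      using Cons(4) by (simp add: image.eval_mult eval_t.eval_mult h mult.assoc)
    also have "\<dots> = (hs_image E H S t x * l (Vert (gen_source G a))) * (Q.rep ?s * l (Vert w))"
      by (subst s) (simp add: mult.assoc)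
    also have "\<dots> = l x * (l (Vert (gen_source G a)) * Q.rep ?s) * l (Vert w)"
      by (simp add: hs_image_action mult.assoc)
    also have "\<dots> = Q.rep (gen x * ?s) * l (Vert w)"
      by (simp add: ring_map_mult[OF Q.ring_map_rep] flip: s)
    finally show ?case .
  next
    case (add p q)
    then show ?case
      by (simp add: image.eval_add eval_t.eval_add ring_map_add[OF Q.ring_map_rep] distrib_right)
  qed
qed

text \<open>If \<open>image.eval p\<close> is zero in L(E), it acts as zero; hence \<open>p\<close>
  annihilates all vertices from the left, and a local unit recovers \<open>p\<close> from these
  products.\<close>

lemma image_injective:
  assumes p: "p \<in> lpa_carrier G" and "image.eval p \<in> lpa_ideal E"
  shows "p \<in> lpa_ideal G"
proof -
  have "lpa_family E (\<lambda>x. eval_t.eval (gen x))"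
    using lpa_family_action by simp
  then have "eval_t.eval r = 0" if "r \<in> lpa_relators E" for r
    using that lpa_family_iff_relators[OF wf_digraph_axioms eval_t.ring_map_eval] by blast
  then have "eval_t.eval (image.eval p) = 0"
    using ring_map_vanishes_on_ideal[OF eval_t.ring_map_eval _ assms(2)] by blast
  then have 0: "Q.rep p * l (Vert w) = 0" for w
    using eval_t_image[OF p, of w] by simp
  obtain W where "finite W" "Q.rep p * (\<Sum>w\<in>W. l (Vert w)) = Q.rep p"
    using exists_local_unit[OF p] by blast
  then have "Q.rep p = 0" using 0 by (simp add: sum_distrib_left)
  then show ?thesis by (simp add: Q.rep_eq_0_iff)
qed

end

section \<open>The isomorphism\<close>

definition homogeneous :: "('v, 'e) pre_digraph \<Rightarrow> int \<Rightarrow> (('v, 'e) lpa_gen word \<Rightarrow>\<^sub>0 'k::field) \<Rightarrow> bool" where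
  "homogeneous E n p \<longleftrightarrow> p \<in> lpa_carrier E \<and>
     (\<forall>w\<in>Poly_Mapping.keys p. sum_list (map gen_degree (letters w)) = n)"

lemma lpa_component_eq: "lpa_component E n = lpa_class E ` {p. homogeneous E n p}"
  by (auto simp: lpa_component_def homogeneous_def)

lemma homogeneous_0: "homogeneous E n 0"
  by (simp add: homogeneous_def)

lemma homogeneous_gen: "homogeneous E n (gen x) \<longleftrightarrow> x \<in> lpa_gens E \<and> gen_degree x = n"
  by (simp add: homogeneous_def)

lemma homogeneous_diff: "homogeneous E n p \<Longrightarrow> homogeneous E n q \<Longrightarrow> homogeneous E n (p - q)"
  using keys_diff[of p q] poly_carrier_diff[of p _ q] unfolding homogeneous_def by blast

lemma homogeneous_add: "homogeneous E n p \<Longrightarrow> homogeneous E n q \<Longrightarrow> homogeneous E n (p + q)"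
  using keys_add[of p q] poly_carrier_add[of p _ q] unfolding homogeneous_def by blast

lemma homogeneous_sum: "(\<And>i. i \<in> A \<Longrightarrow> homogeneous E n (p i)) \<Longrightarrow> homogeneous E n (\<Sum>i\<in>A. p i)"
  by (induction A rule: infinite_finite_induct) (auto intro: homogeneous_0 homogeneous_add)

lemma homogeneous_mult: "homogeneous E m p \<Longrightarrow> homogeneous E n q \<Longrightarrow> homogeneous E (m + n) (p * q)"
  using keys_mult[of p q] poly_carrier_mult[of p _ q]
  by (fastforce simp: homogeneous_def plus_word_def)

lemma homogeneous_const: "homogeneous E n p \<Longrightarrow> homogeneous E n (const c * p)"
  using keys_mult[of "const c" p] poly_carrier_scale[of p _ c]
  by (fastforce simp: homogeneous_def split: if_splits)

lemma alg_ideal_lpa: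
  assumes wf: "wf_digraph E" and I: "alg_ideal (lpa E) I"
  shows "I \<subseteq> lpa_class E ` lpa_carrier E"
    and "lpa_class E 0 \<in> I"
    and "p \<in> lpa_carrier E \<Longrightarrow> q \<in> lpa_carrier E \<Longrightarrow> lpa_class E p \<in> I \<Longrightarrow> lpa_class E q \<in> I
      \<Longrightarrow> lpa_class E (p + q) \<in> I"
    and "p \<in> lpa_carrier E \<Longrightarrow> lpa_class E p \<in> I \<Longrightarrow> lpa_class E (const c * p) \<in> I"
    and "p \<in> lpa_carrier E \<Longrightarrow> q \<in> lpa_carrier E \<Longrightarrow> lpa_class E q \<in> I \<Longrightarrow> lpa_class E (p * q) \<in> I"
    and "p \<in> lpa_carrier E \<Longrightarrow> q \<in> lpa_carrier E \<Longrightarrow> lpa_class E p \<in> I \<Longrightarrow> lpa_class E (p * q) \<in> I"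
  using I unfolding alg_ideal_def alg_subspace_def lpa_carrier_eq lpa_zero
  by (auto simp flip: lpa_add[OF wf] lpa_scale[OF wf] lpa_mult[OF wf])

context hs_data
begin

lemma F_arcs: "p \<in> F \<Longrightarrow> set p \<subseteq> arcs E"
proof (induction p)
  case (Cons e p)
  then show ?case using F_hd_arc[OF Cons(2)] by (cases "p = []") (auto simp: F_Cons)
qed simp

lemma homogeneous_gap: "v \<in> verts E \<Longrightarrow> homogeneous E 0 (gap E H gen v)"
proof -
  assume v: "v \<in> verts E"
  have "homogeneous E 0 (gen (Edge e) * gen (Ghost e))" if "e \<in> arcs E" for e
    using homogeneous_mult[of E 1 "gen (Edge e)" "-1" "gen (Ghost e)"] that by (simp add: homogeneous_gen)
  then show ?thesis
    unfolding gap_def using v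
    by (intro homogeneous_diff homogeneous_sum) (auto simp: homogeneous_gen outside_arcs_def)
qed

lemma homogeneous_path_gap:
  "set p \<subseteq> arcs E \<Longrightarrow> v \<in> verts E \<Longrightarrow> homogeneous E (int (length p)) (path_gap E H gen p v)"
proof (induction p)
  case (Cons e p)
  then show ?case
    using homogeneous_mult[of E 1 "gen (Edge e)" "int (length p)" "path_gap E H gen p v"]
    by (simp add: path_gap_def homogeneous_gen)
qed (simp add: path_gap_def homogeneous_gap)

lemma homogeneous_gap_path:
  shows "set p \<subseteq> arcs E \<Longrightarrow> v \<in> verts E \<Longrightarrow> homogeneous E (- int (length p)) (gap_path E H gen p v :: _ \<Rightarrow>\<^sub>0 'k::field)"
proof (induction p)
  case (Cons e p)
  have *: "- int (length (e # p)) = - int (length p) + - 1" by simp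
  have "homogeneous E (- int (length p) + - 1) (gap_path E H gen p v * gen (Ghost e) :: _ \<Rightarrow>\<^sub>0 'k)"
    using Cons by (intro homogeneous_mult) (simp_all add: homogeneous_gen)
  then show ?case unfolding * by (simp add: gap_path_def)
qed (simp add: gap_path_def homogeneous_gap)

text \<open>The degree is existential because it is not preserved: a new edge has degree 1, but its
  image has the length of the path. Homogeneity of the images is all that gradedness of the ideal
  requires.\<close>

lemma homogeneous_hs_image: "\<exists>n. homogeneous E n (hs_image E H S gen y)"
proof (cases "y \<in> lpa_gens G")
  case y: True
  have path: "set (vpath w) \<subseteq> arcs E" "vrange E w \<in> verts E" if "w \<in> verts G" for w
  proof -
    show "set (vpath w) \<subseteq> arcs E" using that F_arcs by (cases w) auto
    show "vrange E w \<in> verts E" using vrange_HS[OF that] H_verts S_verts by auto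
  qed
  have 1: "homogeneous E (int (length (vpath w))) (path_gap E H gen (vpath w) (vrange E w))"
    "homogeneous E (- int (length (vpath w))) (gap_path E H gen (vpath w) (vrange E w))"
    if "w \<in> verts G" for w
    using homogeneous_path_gap[OF path[OF that]] homogeneous_gap_path[OF path[OF that]] by auto
  show ?thesis
  proof (cases y)
    case (Vert w)
    then show ?thesis using y homogeneous_mult[OF 1(1) 1(2), of w w] by (auto simp: hs_image_def)
  next
    case (Edge a)
    then show ?thesis using y 1(1)[of "Inr p" for p, simplified]
      by (cases a) (auto simp: hs_image_def homogeneous_gen)
  next
    case (Ghost a)
    then show ?thesis using y 1(2)[of "Inr p" for p, simplified]
      by (cases a) (auto simp: hs_image_def homogeneous_gen)
  qed
qed (auto simp: hs_image_def homogeneous_0)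

sublocale image: evaluation const "hs_image E H S gen :: _ \<Rightarrow> ('v, 'e) lpa_gen word \<Rightarrow>\<^sub>0 'k::field"
  by (rule evaluation_const)

abbreviation "\<Phi> \<equiv> image.eval"

lemma homogeneous_image_single:
  fixes c :: "'k::field"
  shows "set xs \<subseteq> lpa_gens G \<Longrightarrow> xs \<noteq> [] \<Longrightarrow> \<exists>n. homogeneous E n (\<Phi> (Poly_Mapping.single (Word xs) c))"
proof (induction xs)
  case (Cons x xs)
  obtain m where m: "homogeneous E m (hs_image E H S gen x :: _ \<Rightarrow>\<^sub>0 'k)" using homogeneous_hs_image by blast
  show ?case
  proof (cases "xs = []")
    case True
    then have "\<Phi> (Poly_Mapping.single (Word (x # xs)) c) = const c * hs_image E H S gen x"
      by (simp add: image.eval_single)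
    then show ?thesis using homogeneous_const[OF m] by auto
  next
    case False
    then obtain n where "homogeneous E n (\<Phi> (Poly_Mapping.single (Word xs) c))" using Cons by auto
    then show ?thesis using homogeneous_mult[OF m] by (auto simp: image.eval_single_Cons)
  qed
qed simp

lemma hs_image_carrier: "hs_image E H S gen y \<in> lpa_carrier E"
  using homogeneous_hs_image[of y] by (auto simp: homogeneous_def)

lemma image_carrier: "p \<in> lpa_carrier G \<Longrightarrow> \<Phi> p \<in> lpa_carrier E"
  by (induction rule: poly_carrier_induct)
    (auto simp: image.eval_0 image.eval_add image.eval_mult
      intro: poly_carrier_add poly_carrier_scale poly_carrier_mult hs_image_carrier)

end

section \<open>The image as a two-sided ideal in the represented L(E)\<close>

locale hs_target = hs_data E H S + Q: quotient_projection "lpa_relators E" P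
  for E :: "('v, 'e) pre_digraph" and H S :: "'v set"
    and P :: "(('v, 'e) lpa_gen word \<Rightarrow>\<^sub>0 'k::field) endo"
begin

sublocale hs_family E H S "\<lambda>x. Q.rep (gen x)"
proof (intro hs_family.intro hs_data_axioms)
  show "lpa_family E (\<lambda>x. Q.rep (gen x))"
    unfolding lpa_family_iff_relators[OF wf_digraph_axioms Q.ring_map_rep]
    by (auto simp: Q.rep_eq_0_iff intro: two_sided_ideal_incl)
qed

sublocale G: lpa_family G h
  by (rule lpa_family_hs_image)

abbreviation himage :: "_ \<Rightarrow> ('v, 'e) lpa_gen word \<Rightarrow>\<^sub>0 'k" where
  "himage \<equiv> hs_image E H S gen"

definition "f p = Q.rep (\<Phi> p)"

lemma ring_map_f: "ring_map f"
  using ring_map_add[OF Q.ring_map_rep] ring_map_mult[OF Q.ring_map_rep]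
  by (simp add: ring_map_def f_def image.eval_add image.eval_mult)

lemma rep_hs_image: "Q.rep (himage y) = h y"
  by (rule hs_image_ring_map[OF Q.ring_map_rep])

lemma f_gen: "f (gen y) = h y"
  by (simp add: f_def rep_hs_image)

lemma f_const: "f (const c * p) = left_mult (const c) * f p"
  by (simp add: f_def image.eval_mult Q.left_mult_const_rep)

lemma image_ideal:
  fixes p :: "('v + 'e list, 'e + 'e list) lpa_gen word \<Rightarrow>\<^sub>0 'k"
  assumes "p \<in> lpa_ideal G"
  shows "\<Phi> p \<in> lpa_ideal E"
proof -
  have "lpa_family G (\<lambda>x. f (gen x))"
    using lpa_family_hs_image by (simp add: f_gen)
  then have "f p = 0"
    using ring_map_vanishes_on_ideal[OF ring_map_f _ assms] lpa_family_iff_relators[OF wf_G ring_map_f]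
    by blast
  then show ?thesis by (simp add: f_def Q.rep_eq_0_iff)
qed

definition "B = f ` lpa_carrier G"

lemma B_add: "a \<in> B \<Longrightarrow> b \<in> B \<Longrightarrow> a + b \<in> B"
  by (auto simp: B_def simp flip: ring_map_add[OF ring_map_f] intro: poly_carrier_add)

lemma B_mult: "a \<in> B \<Longrightarrow> b \<in> B \<Longrightarrow> a * b \<in> B"
  by (auto simp: B_def simp flip: ring_map_mult[OF ring_map_f] intro: poly_carrier_mult)

lemma B_const: "a \<in> B \<Longrightarrow> left_mult (const c) * a \<in> B"
  by (auto simp: B_def simp flip: f_const intro: poly_carrier_scale)

lemma B_0: "0 \<in> B"
  using ring_map_0[OF ring_map_f] by (force simp: B_def)

lemma B_gen: "h y \<in> B"
proof (cases "y \<in> lpa_gens G")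
  case True
  then show ?thesis unfolding f_gen[symmetric] B_def by simp
next
  case False
  then show ?thesis using G.outside[of y] B_0 by simp
qed

lemma B_gen_products: "b \<in> gen_products h \<Longrightarrow> b \<in> B"
  by (auto simp: gen_products_def B_0 B_gen B_mult)

lemma rep_left_mult_const: "Q.rep p * left_mult (const c) = left_mult (const c) * Q.rep p"
proof (rule endo_eqI)
  fix n
  have "p * (const c * n) = const c * (p * n)"
    by (simp only: const_commute[of c] mult.assoc)
  then show "app (Q.rep p * left_mult (const c)) n = app (left_mult (const c) * Q.rep p) n"
    by (simp add: app_simps Q.app_rep Q.linear)
qed

text \<open>The image of a generator absorbs its source vertex on the left; multiplying this vertex
  by a generator of \<open>E\<close> gives a table entry, which consists of images again.\<close>

lemma gen_f: "p \<in> lpa_carrier G \<Longrightarrow> Q.rep (gen x) * f p \<in> B"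
proof (induction rule: poly_carrier_induct)
  have h: "Q.rep (gen x) * h y \<in> B" for y
  proof (cases "gen_source G y \<in> verts G")
    case True
    have "Q.rep (gen x) * h y = left_action E H S h x (gen_source G y) * h y"
      unfolding gen_hs_vertex[OF True, symmetric] by (simp add: mult.assoc G.vert_gen)
    then show ?thesis
      using B_gen_products[OF left_action_products] by (simp add: B_mult B_gen)
  next
    case False
    then have "h y = 0" using G.vert_gen[of "gen_source G y" y] G.outside[of "Vert (gen_source G y)"] by simp
    then show ?thesis by (simp add: B_0)
  qed
  {
    case (gen y c)
    have "Q.rep (gen x) * (left_mult (const c) * h y) = left_mult (const c) * (Q.rep (gen x) * h y)"
      by (simp add: rep_left_mult_const flip: mult.assoc)
    then show ?case using h[of y] by (simp add: f_const f_gen B_const)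
  next
    case (Cons y ys c)
    then have "f (Poly_Mapping.single (Word ys) c) \<in> B"
      by (auto simp: B_def poly_carrier_iff)
    then show ?case using h[of y]
      by (simp add: ring_map_mult[OF ring_map_f] f_gen B_mult flip: mult.assoc)
  }
qed (simp_all add: ring_map_0[OF ring_map_f] ring_map_add[OF ring_map_f] distrib_left B_0 B_add)

lemma f_gen_right: "p \<in> lpa_carrier G \<Longrightarrow> f p * Q.rep (gen x) \<in> B"
proof (induction rule: poly_carrier_induct)
  case (gen y c)
  have "h y * Q.rep (gen x) \<in> B"
  proof (cases "gen_range G y \<in> verts G")
    case True
    have "h y * Q.rep (gen x) = h y * (h (Vert (gen_range G y)) * Q.rep (gen x))"
      by (simp add: G.gen_vert flip: mult.assoc)
    then show ?thesis
      using B_gen_products[OF hs_vertex_gen[OF True]] by (simp add: B_mult B_gen)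
  next
    case False
    then have "h y = 0" using G.gen_vert[of y "gen_range G y"] G.outside[of "Vert (gen_range G y)"] by simp
    then show ?thesis by (simp add: B_0)
  qed
  then show ?case by (simp add: f_const f_gen B_const mult.assoc)
qed (simp_all add: ring_map_0[OF ring_map_f] ring_map_add[OF ring_map_f] ring_map_mult[OF ring_map_f]
    f_gen distrib_right B_0 B_add B_mult B_gen mult.assoc)

lemma rep_B:
  assumes "a \<in> lpa_carrier E" "b \<in> B"
  shows "Q.rep a * b \<in> B" "b * Q.rep a \<in> B"
proof -
  have B_rep: "Q.rep (gen x) * b \<in> B" "b * Q.rep (gen x) \<in> B" if "b \<in> B" for x b
    using that gen_f f_gen_right by (auto simp: B_def)
  have const: "b * (left_mult (const c) * z) = left_mult (const c) * (b * z)" if "b \<in> B" for b z c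
  proof -
    from that obtain p where "b = f p" unfolding B_def by blast
    then show ?thesis using rep_left_mult_const[of "\<Phi> p" c] by (simp add: f_def flip: mult.assoc)
  qed
  have "\<forall>b\<in>B. Q.rep a * b \<in> B \<and> b * Q.rep a \<in> B"
    using assms(1)
  proof (induction rule: poly_carrier_induct)
    case (gen x c)
    then show ?case
      using B_rep by (auto simp: mult.assoc const B_const simp flip: Q.left_mult_const_rep)
  next
    case (Cons x xs c)
    show ?case
    proof
      fix b assume b: "b \<in> B"
      show "Q.rep (gen x * Poly_Mapping.single (Word xs) c) * b \<in> B \<and>
          b * Q.rep (gen x * Poly_Mapping.single (Word xs) c) \<in> B"
        using Cons(4) B_rep b by (simp add: ring_map_mult[OF Q.ring_map_rep] mult.assoc)
          (simp flip: mult.assoc)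
    qed
  qed (simp_all add: ring_map_0[OF Q.ring_map_rep] ring_map_add[OF Q.ring_map_rep]
      distrib_left distrib_right B_0 B_add)
  then show "Q.rep a * b \<in> B" "b * Q.rep a \<in> B" using assms(2) by auto
qed

lemma image_multiples:
  fixes p :: "('v + 'e list, 'e + 'e list) lpa_gen word \<Rightarrow>\<^sub>0 'k"
  assumes "a \<in> lpa_carrier E" "p \<in> lpa_carrier G"
  shows "\<exists>p'\<in>lpa_carrier G. a * \<Phi> p - \<Phi> p' \<in> lpa_ideal E"
    and "\<exists>p'\<in>lpa_carrier G. \<Phi> p * a - \<Phi> p' \<in> lpa_ideal E"
proof -
  have "f p \<in> B" using assms by (simp add: B_def)
  from rep_B[OF assms(1) this] obtain p1 p2 where "p1 \<in> lpa_carrier G" "p2 \<in> lpa_carrier G"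
    "Q.rep (a * \<Phi> p) = Q.rep (\<Phi> p1)" "Q.rep (\<Phi> p * a) = Q.rep (\<Phi> p2)"
    by (auto simp: B_def f_def ring_map_mult[OF Q.ring_map_rep])
  then show "\<exists>p'\<in>lpa_carrier G. a * \<Phi> p - \<Phi> p' \<in> lpa_ideal E"
    "\<exists>p'\<in>lpa_carrier G. \<Phi> p * a - \<Phi> p' \<in> lpa_ideal E"
    by (auto simp: Q.rep_eq_iff)
qed

lemma rep_gap: "Q.rep (gap E H gen v) = q v"
  by (simp add: gap_def ring_map_diff[OF Q.ring_map_rep] ring_map_sum[OF Q.ring_map_rep]
      ring_map_mult[OF Q.ring_map_rep])

lemma hs_image_vertex_gap:
  assumes "v \<in> H \<union> S"
  shows "himage (Vert (Inl v)) - (gap E H gen v :: ('v, 'e) lpa_gen word \<Rightarrow>\<^sub>0 'k) \<in> lpa_ideal E"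
  using hs_image_Inl[OF assms] by (simp add: rep_gap rep_hs_image flip: Q.rep_eq_iff)

text \<open>Exhibits a new vertex as a multiple of an old one, so an ideal containing the gaps
  contains the images of all new vertices.\<close>

lemma hs_image_vertex_path:
  assumes "p \<in> F"
  shows "himage (Vert (Inr p)) - himage (Edge (Inr p))
     * (himage (Vert (Inl (head E (last p)))) * himage (Ghost (Inr p))) \<in> lpa_ideal E"
  using G.regular_sum[of "Inr p"] assms ends_G
  by (simp add: rep_hs_image ring_map_mult[OF Q.ring_map_rep] G.lpa_simps regular_vertex_def out_arcs_G
      flip: Q.rep_eq_iff)

lemma hs_image_range:
  "himage y - himage y * himage (Vert (gen_range G y)) \<in> lpa_ideal E"
  by (simp add: rep_hs_image ring_map_mult[OF Q.ring_map_rep] G.gen_vert flip: Q.rep_eq_iff)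

end

section \<open>Identification of the ideal, its grading and the isomorphism\<close>

context hs_data
begin

lemma obtain_target:
  obtains P :: "(('v, 'e) lpa_gen word \<Rightarrow>\<^sub>0 'k::field) endo" where "hs_target E H S P"
  using exists_quotient_projection[of "lpa_relators E"]
  by (auto intro: hs_target.intro hs_data_axioms)

text \<open>Right to left the map on classes is well defined, left to right it is injective. The
  statement mentions no projection, so one for each graph is chosen inside the proof.\<close>

lemma image_class_inject:
  fixes p q :: "('v + 'e list, 'e + 'e list) lpa_gen word \<Rightarrow>\<^sub>0 'k::field"
  assumes p: "p \<in> lpa_carrier G" and q: "q \<in> lpa_carrier G"
  shows "lpa_class E (\<Phi> p) = lpa_class E (\<Phi> q) \<longleftrightarrow> lpa_class G p = lpa_class G q"
proof -
  obtain P :: "(('v, 'e) lpa_gen word \<Rightarrow>\<^sub>0 'k) endo" where "hs_target E H S P" by (rule obtain_target)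
  then interpret T: hs_target E H S P .
  obtain P' :: "(('v + 'e list, 'e + 'e list) lpa_gen word \<Rightarrow>\<^sub>0 'k) endo"
    where "quotient_projection (lpa_relators G) P'"
    using exists_quotient_projection by blast
  then interpret R: hs_projection E H S P'
    by (intro hs_projection.intro hs_data_axioms)
  have "\<Phi> p - \<Phi> q = \<Phi> (p - q)"
    by (simp add: ring_map_diff[OF image.ring_map_eval])
  then show ?thesis
    using T.image_ideal[of "p - q"] R.image_injective[of "p - q"] poly_carrier_diff[OF p q]
    by (auto simp: lpa_class_eq_iff[OF wf_digraph_axioms] lpa_class_eq_iff[OF wf_G] image_carrier p q)
qed

lemma ideal_HS_eq:
  "(ideal_HS E H S :: ('v, 'e, 'k::field) lpa_elem set) = (\<lambda>p. lpa_class E (\<Phi> p)) ` lpa_carrier G"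
    (is "_ = ?R")
proof -
  note wf = wf_digraph_axioms
  obtain P :: "(('v, 'e) lpa_gen word \<Rightarrow>\<^sub>0 'k) endo" where "hs_target E H S P" by (rule obtain_target)
  then interpret T: hs_target E H S P .
  let ?gens = "(\<lambda>v. lpa_class E (gen (Vert v))) ` H \<union> gap_idempotent E H ` S :: ('v, 'e, 'k) lpa_elem set"
  have gens: "?gens = (\<lambda>v. lpa_class E (gap E H gen v)) ` (H \<union> S)"
    unfolding image_Un by (auto simp: gap_idempotent_def gap_def outside_arcs_H)
  note gap_carrier = conjunct1[OF homogeneous_gap[unfolded homogeneous_def]]
  show ?thesis
  proof
    have "alg_ideal (lpa E) ?R"
      unfolding alg_ideal_def alg_subspace_def lpa_carrier_eq lpa_zero
    proof (intro conjI ballI allI; (elim imageE; hypsubst)?)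
      show "?R \<subseteq> lpa_class E ` lpa_carrier E" by (auto intro: image_carrier)
      show "lpa_class E 0 \<in> ?R" by (rule image_eqI[of _ _ 0]) (simp_all add: image.eval_0)
    next
      fix p q :: "('v + 'e list, 'e + 'e list) lpa_gen word \<Rightarrow>\<^sub>0 'k" assume "p \<in> lpa_carrier G" "q \<in> lpa_carrier G"
      then show "aadd (lpa E) (lpa_class E (\<Phi> p)) (lpa_class E (\<Phi> q)) \<in> ?R"
        by (auto simp: lpa_add[OF wf] image_carrier image.eval_add intro!: image_eqI[of _ _ "p + q"]
            poly_carrier_add)
    next
      fix c and p :: "('v + 'e list, 'e + 'e list) lpa_gen word \<Rightarrow>\<^sub>0 'k" assume "p \<in> lpa_carrier G"
      then show "ascale (lpa E) c (lpa_class E (\<Phi> p)) \<in> ?R"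
        by (auto simp: lpa_scale[OF wf] image_carrier image.eval_mult intro!: image_eqI[of _ _ "const c * p"]
            poly_carrier_scale)
    next
      fix a :: "('v, 'e) lpa_gen word \<Rightarrow>\<^sub>0 'k" and p :: "('v + 'e list, 'e + 'e list) lpa_gen word \<Rightarrow>\<^sub>0 'k" assume a: "a \<in> lpa_carrier E" and p: "p \<in> lpa_carrier G"
      obtain p1 p2 where "p1 \<in> lpa_carrier G" "a * \<Phi> p - \<Phi> p1 \<in> lpa_ideal E"
        "p2 \<in> lpa_carrier G" "\<Phi> p * a - \<Phi> p2 \<in> lpa_ideal E"
        using T.image_multiples[OF a p] by auto
      then have "lpa_class E (a * \<Phi> p) = lpa_class E (\<Phi> p1)" "lpa_class E (\<Phi> p * a) = lpa_class E (\<Phi> p2)"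
        by (simp_all add: lpa_class_eq_iff[OF wf] image_carrier a p poly_carrier_mult)
      then show "amult (lpa E) (lpa_class E a) (lpa_class E (\<Phi> p)) \<in> ?R"
        "amult (lpa E) (lpa_class E (\<Phi> p)) (lpa_class E a) \<in> ?R"
        using \<open>p1 \<in> _\<close> \<open>p2 \<in> _\<close> by (simp_all add: lpa_mult[OF wf] a p image_carrier)
    qed
    moreover have "?gens \<subseteq> ?R"
    proof -
      have "lpa_class E (gap E H gen v) \<in> ?R" if v: "v \<in> H \<union> S" for v
      proof (rule image_eqI[of _ _ "gen (Vert (Inl v))"])
        have "v \<in> verts E" using v H_verts S_verts by auto
        then have "lpa_class E (hs_image E H S gen (Vert (Inl v))) = lpa_class E (gap E H gen v :: _ \<Rightarrow>\<^sub>0 'k)"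
          using T.hs_image_vertex_gap[OF v]
          by (simp add: lpa_class_eq_iff[OF wf] hs_image_carrier gap_carrier)
        then show "lpa_class E (gap E H gen v) = lpa_class E (\<Phi> (gen (Vert (Inl v))) :: _ \<Rightarrow>\<^sub>0 'k)"
          by simp
        show "gen (Vert (Inl v)) \<in> lpa_carrier G" using v by simp
      qed
      then show ?thesis unfolding gens by blast
    qed
    ultimately show "ideal_HS E H S \<subseteq> ?R"
      unfolding ideal_HS_def alg_genideal_def by blast
  next
    show "?R \<subseteq> ideal_HS E H S"
      unfolding ideal_HS_def alg_genideal_def
    proof (intro subsetI InterI, elim imageE CollectE conjE, hypsubst)
      fix I :: "('v, 'e, 'k) lpa_elem set" and p :: "('v + 'e list, 'e + 'e list) lpa_gen word \<Rightarrow>\<^sub>0 'k"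
      assume p: "p \<in> lpa_carrier G" and I: "alg_ideal (lpa E) I" and gensI: "?gens \<subseteq> I"
      note I_rules = alg_ideal_lpa[OF wf I]
      let ?h = "\<lambda>y. hs_image E H S gen y :: _ \<Rightarrow>\<^sub>0 'k"
      have cong: "lpa_class E a = lpa_class E b" if "a - b \<in> lpa_ideal E" "a \<in> lpa_carrier E" "b \<in> lpa_carrier E"
        for a b :: "('v, 'e) lpa_gen word \<Rightarrow>\<^sub>0 'k"
        using that by (simp add: lpa_class_eq_iff[OF wf])
      \<comment> \<open>Membership in \<open>I\<close> spreads from the gaps, which are the images
        of old vertices, to new vertices and then to all generators, each a multiple of the image of
        its range vertex.\<close>
      have old: "lpa_class E (?h (Vert (Inl v))) \<in> I" if v: "v \<in> H \<union> S" for v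
      proof -
        have "v \<in> verts E" using v H_verts S_verts by auto
        then show ?thesis
          using cong[OF T.hs_image_vertex_gap[OF v] hs_image_carrier gap_carrier] gensI v
          unfolding gens by auto
      qed
      have vertex: "lpa_class E (?h (Vert w)) \<in> I" if w: "w \<in> verts G" for w
      proof (cases w)
        case (Inl v)
        then show ?thesis using old w by simp
      next
        case (Inr p)
        then have p: "p \<in> F" using w by simp
        show ?thesis
          unfolding Inr cong[OF T.hs_image_vertex_path[OF p] hs_image_carrier
              poly_carrier_mult[OF hs_image_carrier poly_carrier_mult[OF hs_image_carrier hs_image_carrier]]]
          by (intro I_rules(5,6) poly_carrier_mult hs_image_carrier old F_last[OF p])
      qed
      have generators: "lpa_class E (?h y) \<in> I" if y: "y \<in> lpa_gens G" for y
      proof -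
        have "gen_range G y \<in> verts G"
          using y wf_digraph.tail_in_verts[OF wf_G] wf_digraph.head_in_verts[OF wf_G] by (cases y) auto
        then show ?thesis
          unfolding cong[OF T.hs_image_range hs_image_carrier poly_carrier_mult[OF hs_image_carrier hs_image_carrier]]
          by (intro I_rules(5) hs_image_carrier vertex)
      qed
      from p have "\<Phi> p \<in> lpa_carrier E \<and> lpa_class E (\<Phi> p) \<in> I"
      proof (induction rule: poly_carrier_induct)
        case zero
        then show ?case by (simp add: image.eval_0 I_rules(2))
      next
        case (gen x c)
        then show ?case
          by (auto simp: image.eval_mult intro!: I_rules(4) generators hs_image_carrier poly_carrier_scale)
      next
        case (Cons x xs c)
        then show ?case
          by (auto simp: image.eval_mult intro!: I_rules(6) generators hs_image_carrier poly_carrier_mult)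
      next
        case (add p q)
        then show ?case by (auto simp: image.eval_add intro!: I_rules(3) poly_carrier_add)
      qed
      then show "lpa_class E (\<Phi> p) \<in> I" ..
    qed
  qed
qed

text \<open>An intersection over an empty family would be the whole type; the carrier is an ideal
  containing the generators, so it belongs to the family.\<close>

lemma alg_ideal_HS: "alg_ideal (lpa E) (ideal_HS E H S :: ('v, 'e, 'k::field) lpa_elem set)"
proof -
  note wf = wf_digraph_axioms
  have closed: "alg_ideal (lpa E) (lpa_class E ` lpa_carrier E :: ('v, 'e, 'k) lpa_elem set)"
    unfolding alg_ideal_def alg_subspace_def lpa_carrier_eq lpa_zero
    by (auto simp: lpa_add[OF wf] lpa_mult[OF wf] lpa_scale[OF wf]
        intro: poly_carrier_add poly_carrier_mult poly_carrier_scale)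
  have "gap E H gen v \<in> (lpa_carrier E :: (_ \<Rightarrow>\<^sub>0 'k) set)" if "v \<in> H \<union> S" for v
    using homogeneous_gap[of v] that H_verts S_verts by (auto simp: homogeneous_def)
  then have "(\<lambda>v. lpa_class E (gen (Vert v))) ` H \<union> gap_idempotent E H ` S
      \<subseteq> (lpa_class E ` lpa_carrier E :: ('v, 'e, 'k) lpa_elem set)"
    using H_verts by (auto simp: gap_idempotent_def gap_def)
  with closed show ?thesis
    unfolding ideal_HS_def alg_genideal_def alg_ideal_def[of _ "\<Inter>_"] alg_subspace_def[of _ "\<Inter>_"]
    by (auto simp: alg_ideal_def alg_subspace_def lpa_carrier_eq)
qed

lemma graded_ideal_HS:
  "graded_ideal (lpa E) (lpa_component E) (ideal_HS E H S :: ('v, 'e, 'k::field) lpa_elem set)"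
proof -
  note wf = wf_digraph_axioms
  let ?I = "ideal_HS E H S :: ('v, 'e, 'k) lpa_elem set"
  let ?X = "\<Union>n. ?I \<inter> lpa_component E n"
  have "alg_ideal (lpa E) ?I" by (rule alg_ideal_HS)
  then have "alg_subspace (lpa E) ?I" by (simp add: alg_ideal_def)
  then have "alg_span (lpa E) ?X \<subseteq> ?I"
    unfolding alg_span_def by blast
  moreover have "?I \<subseteq> alg_span (lpa E) ?X"
    unfolding alg_span_def
  proof (intro subsetI InterI, elim CollectE conjE)
    fix x and V :: "('v, 'e, 'k) lpa_elem set"
    assume "x \<in> ?I" and V: "alg_subspace (lpa E) V" and XV: "?X \<subseteq> V"
    then obtain p :: "('v + 'e list, 'e + 'e list) lpa_gen word \<Rightarrow>\<^sub>0 'k"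
      where p: "p \<in> lpa_carrier G" and x: "x = lpa_class E (\<Phi> p)"
      unfolding ideal_HS_eq by blast
    \<comment> \<open>A single word has a homogeneous image, so its class already lies in one of the
      spanning intersections; sums of words then give everything.\<close>
    have single: "lpa_class E (\<Phi> (Poly_Mapping.single (Word xs) c)) \<in> V"
      if xs: "set xs \<subseteq> lpa_gens G" "xs \<noteq> []" for xs and c :: 'k
    proof -
      obtain n where "homogeneous E n (\<Phi> (Poly_Mapping.single (Word xs) c))"
        using homogeneous_image_single[OF xs] by blast
      then have "lpa_class E (\<Phi> (Poly_Mapping.single (Word xs) c)) \<in> lpa_component E n"
        unfolding lpa_component_eq by blast
      moreover have "Poly_Mapping.single (Word xs) c \<in> lpa_carrier G"
        using xs by (simp add: poly_carrier_iff)
      ultimately show ?thesis using XV unfolding ideal_HS_eq by blast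
    qed
    from p have "\<Phi> p \<in> lpa_carrier E \<and> lpa_class E (\<Phi> p) \<in> V"
    proof (induction rule: poly_carrier_induct)
      case zero
      then show ?case using V by (simp add: image.eval_0 alg_subspace_def lpa_zero)
    next
      case (gen x c)
      have "const c * gen x = Poly_Mapping.single (Word [x]) c"
        by (simp add: gen_def mult_single)
      then show ?case
        using single[of "[x]" c] gen image_carrier[of "const c * gen x"] by (simp add: poly_carrier_iff)
    next
      case (Cons x xs c)
      have "Poly_Mapping.single (Word (x # xs)) c \<in> lpa_carrier G"
        using Cons by (simp add: poly_carrier_iff)
      then show ?case
        using single[of "x # xs" c] Cons(1,3) image_carrier by (simp flip: single_Cons)
    next
      case (add p q)
      then show ?case
        using V unfolding alg_subspace_def
        by (auto simp: image.eval_add poly_carrier_add simp flip: lpa_add[OF wf])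
    qed
    then show "x \<in> V" unfolding x ..
  qed
  ultimately show ?thesis
    using alg_ideal_HS unfolding graded_ideal_def by blast
qed

lemma isomorphic_ideal_HS:
  "alg_isomorphic (ideal_algebra E H S :: ('k::field, ('v, 'e, 'k) lpa_elem) nu_algebra) (lpa G)"
proof -
  note wf = wf_digraph_axioms
  \<comment> \<open>The inverse of the map induced by \<open>\<Phi>\<close>; by
    \<open>image_class_inject\<close> the class does not depend on the chosen preimage.\<close>
  define f where "f X = lpa_class G (SOME p. p \<in> lpa_carrier G \<and> lpa_class E (\<Phi> p) = X)"
    for X :: "('v, 'e, 'k) lpa_elem"
  have f: "f (lpa_class E (\<Phi> p)) = lpa_class G p" if p: "p \<in> lpa_carrier G" for p
  proof -
    let ?p = "SOME p'. p' \<in> lpa_carrier G \<and> lpa_class E (\<Phi> p') = lpa_class E (\<Phi> p)"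
    have "?p \<in> lpa_carrier G \<and> lpa_class E (\<Phi> ?p) = lpa_class E (\<Phi> p)"
      by (rule someI[of _ p]) (simp add: p)
    then show ?thesis
      unfolding f_def using image_class_inject[of ?p p] p by blast
  qed
  have ops: "acarrier (ideal_algebra E H S) = (\<lambda>p. lpa_class E (\<Phi> p)) ` lpa_carrier G"
    "aadd (ideal_algebra E H S) = aadd (lpa E)" "amult (ideal_algebra E H S) = amult (lpa E)"
    "ascale (ideal_algebra E H S) = ascale (lpa E)"
    by (simp_all add: ideal_algebra_def ideal_HS_eq)
  have "alg_iso (ideal_algebra E H S) (lpa G) f"
    unfolding alg_iso_def ops
  proof (intro conjI ballI allI; (elim imageE; hypsubst)?)
    show "bij_betw f ((\<lambda>p. lpa_class E (\<Phi> p)) ` lpa_carrier G) (acarrier (lpa G))"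
      unfolding bij_betw_def lpa_carrier_eq
    proof
      show "inj_on f ((\<lambda>p. lpa_class E (\<Phi> p)) ` lpa_carrier G)"
        by (rule inj_onI, elim imageE, hypsubst) (simp add: f image_class_inject)
      show "f ` (\<lambda>p. lpa_class E (\<Phi> p)) ` lpa_carrier G = lpa_class G ` lpa_carrier G"
        by (simp add: image_image f)
    qed
  next
    fix p q :: "('v + 'e list, 'e + 'e list) lpa_gen word \<Rightarrow>\<^sub>0 'k"
    assume p: "p \<in> lpa_carrier G" and q: "q \<in> lpa_carrier G"
    show "f (aadd (lpa E) (lpa_class E (\<Phi> p)) (lpa_class E (\<Phi> q)))
        = aadd (lpa G) (f (lpa_class E (\<Phi> p))) (f (lpa_class E (\<Phi> q)))"
      using f[of "p + q"] p q
      by (simp add: lpa_add[OF wf] lpa_add[OF wf_G] image_carrier f image.eval_add poly_carrier_add)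
    show "f (amult (lpa E) (lpa_class E (\<Phi> p)) (lpa_class E (\<Phi> q)))
        = amult (lpa G) (f (lpa_class E (\<Phi> p))) (f (lpa_class E (\<Phi> q)))"
      using f[of "p * q"] p q
      by (simp add: lpa_mult[OF wf] lpa_mult[OF wf_G] image_carrier f image.eval_mult poly_carrier_mult)
  next
    fix c and p :: "('v + 'e list, 'e + 'e list) lpa_gen word \<Rightarrow>\<^sub>0 'k"
    assume p: "p \<in> lpa_carrier G"
    show "f (ascale (lpa E) c (lpa_class E (\<Phi> p))) = ascale (lpa G) c (f (lpa_class E (\<Phi> p)))"
      using f[of "const c * p"] p
      by (simp add: lpa_scale[OF wf] lpa_scale[OF wf_G] image_carrier f image.eval_mult poly_carrier_scale)
  qed
  then show ?thesis unfolding alg_isomorphic_def by blast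
qed

end

theorem theorem6p1:
  fixes E :: "('v, 'e) pre_digraph" and H S :: "'v set"
  assumes "wf_digraph E"
    and "hereditary E H" and "saturated E H"
    and "S \<subseteq> breaking_vertices E H"
  shows "graded_ideal (lpa E) (lpa_component E)
           (ideal_HS E H S :: ('v, 'e, 'k::field) lpa_elem set)
       \<and> alg_isomorphic
           (ideal_algebra E H S :: ('k, ('v, 'e, 'k) lpa_elem) nu_algebra)
           (lpa (hs_graph E H S))"
proof -
  interpret hs_data E H S
    using assms by (intro hs_data.intro hs_data_axioms.intro)
  show ?thesis
    using graded_ideal_HS isomorphic_ideal_HS by blast
qed

end
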